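(* Let $M$ be a manifold of dimension $n\ge2$ equipped with a scale connection $\nabla$ (a torsion-free affine connection with symmetric projective Schouten tensor). For each $k\in\mathbb{Z}_{>0}$ define a curvature form $p_k$ on $(M,\nabla)$ by $$(p_k)_{a_1a_2\cdots a_{2k}}:=R_{a_1a_2}{}^{c_1}{}_{c_2}R_{a_3a_4}{}^{c_2}{}_{c_3}\cdots R_{a_{2k-1}a_{2k}}{}^{c_k}{}_{c_1},$$ where here and below the indices $a_1,\dots,a_{2k}$ are skewed over. Then $$(p_k)_{a_1a_2\cdots a_{2k}}=W_{a_1a_2}{}^{c_1}{}_{c_2}W_{a_3a_4}{}^{c_2}{}_{c_3}\cdots W_{a_{2k-1}a_{2k}}{}^{c_k}{}_{c_1},$$ where $W$ is the projective Weyl curvature, and so $p_k$ depends only on the projective class $[\nabla]$ of $\nabla$.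
   Context: All fields are smooth. Two torsion-free affine connections $\nabla,\widehat\nabla$ are projectively equivalent (have the same unparametrised geodesics) iff there is a 1-form $\Upsilon_a$ with $\widehat\nabla_aY^b=\nabla_aY^b+\Upsilon_aY^b+\Upsilon_cY^c\delta_a^b$; $[\nabla]$ denotes the class. Curvature: $(\nabla_a\nabla_b-\nabla_b\nabla_a)v^c=R_{ab}{}^c{}_dv^d$, $\mathrm{Ric}_{ab}=R_{ca}{}^c{}_b$. One has a unique decomposition $R_{ab}{}^c{}_d=W_{ab}{}^c{}_d+2\delta^c_{[a}P_{b]d}+\beta_{ab}\delta^c_d$ with $W$ (the projective Weyl tensor) completely trace-free and $\beta_{ab}=-2P_{[ab]}$; here $P$ is the projective Schouten tensor, $(n-1)P_{ab}=\mathrm{Ric}_{ab}+\beta_{ab}$. $P$ is symmetric iff $\mathrm{Ric}$ is symmetric, and then $\beta=0$. Square brackets denote antisymmetrisation. *)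

theory Defs
  imports "HOL-Analysis.Analysis" "HOL-Combinatorics.Permutations"
begin

section \<open>Smooth manifolds\<close>

text \<open>Meant for open \<open>S\<close>: class \<open>C\<^sup>k\<close>, through iterated directional derivatives.\<close>

primrec Ck_on :: "nat \<Rightarrow> (real^'n \<Rightarrow> 'b::real_normed_vector) \<Rightarrow> (real^'n) set \<Rightarrow> bool" where
  "Ck_on 0 f S \<longleftrightarrow> continuous_on S f"
| "Ck_on (Suc k) f S \<longleftrightarrow>
     (\<forall>x\<in>S. f differentiable (at x)) \<and> (\<forall>v. Ck_on k (\<lambda>x. frechet_derivative f (at x) v) S)"

definition smooth_on :: "(real^'n) set \<Rightarrow> (real^'n \<Rightarrow> 'b::real_normed_vector) \<Rightarrow> bool" where
  "smooth_on S f \<longleftrightarrow> (\<forall>k. Ck_on k f S)"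

text \<open>A chart is a domain with a coordinate map; the values of the map off the domain are
  irrelevant.\<close>

type_synonym ('a, 'n) chart = "'a set \<times> ('a \<Rightarrow> real^'n)"

abbreviation dom_chart :: "('a, 'n::finite) chart \<Rightarrow> 'a set" where
  "dom_chart c \<equiv> fst c"

abbreviation coord :: "('a, 'n::finite) chart \<Rightarrow> 'a \<Rightarrow> real^'n" where
  "coord c \<equiv> snd c"

definition in_chart :: "('a, 'n::finite) chart \<Rightarrow> ('a \<Rightarrow> 'b) \<Rightarrow> real^'n \<Rightarrow> 'b" where
  "in_chart c f = f \<circ> inv_into (dom_chart c) (coord c)"

definition smooth_manifold :: "'a topology \<Rightarrow> ('a, 'n::finite) chart set \<Rightarrow> bool" where
  "smooth_manifold M A \<longleftrightarrow>
     Hausdorff_space M \<and> second_countable M \<and>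
     (\<Union>c\<in>A. dom_chart c) = topspace M \<and>
     (\<forall>c\<in>A. openin M (dom_chart c) \<and> open (coord c ` dom_chart c) \<and>
        homeomorphic_map (subtopology M (dom_chart c)) (top_of_set (coord c ` dom_chart c)) (coord c)) \<and>
     (\<forall>c\<in>A. \<forall>d\<in>A. smooth_on (coord c ` (dom_chart c \<inter> dom_chart d)) (in_chart c (coord d)))"

section \<open>Fields\<close>

text \<open>The differential at \<open>p\<close> of a map on the manifold, acting on tangent vectors given by their
  components in the chart \<open>c\<close>. For \<open>f = coord d\<close> this is the Jacobian of the change of charts.\<close>

definition chart_deriv :: "('a, 'n::finite) chart \<Rightarrow> ('a \<Rightarrow> 'b::real_normed_vector) \<Rightarrow> 'a \<Rightarrow> real^'n \<Rightarrow> 'b" where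
  "chart_deriv c f p v = frechet_derivative (in_chart c f) (at (coord c p)) v"

definition smooth_function :: "('a, 'n::finite) chart set \<Rightarrow> ('a \<Rightarrow> real) \<Rightarrow> bool" where
  "smooth_function A f \<longleftrightarrow> (\<forall>c\<in>A. smooth_on (coord c ` dom_chart c) (in_chart c f))"

text \<open>A vector field is the family of its component functions in all charts, related by the
  transformation law. The components are set to zero where they carry no information, so that
  equality of fields is equality of functions.\<close>

type_synonym ('a, 'n) field = "('a, 'n) chart \<Rightarrow> 'a \<Rightarrow> real^'n"

definition vector_field :: "('a, 'n::finite) chart set \<Rightarrow> ('a, 'n) field \<Rightarrow> bool" where
  "vector_field A X \<longleftrightarrow>
     (\<forall>c p. c \<notin> A \<or> p \<notin> dom_chart c \<longrightarrow> X c p = 0) \<and>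
     (\<forall>c\<in>A. smooth_on (coord c ` dom_chart c) (in_chart c (X c))) \<and>
     (\<forall>c\<in>A. \<forall>d\<in>A. \<forall>p\<in>dom_chart c \<inter> dom_chart d. X d p = chart_deriv c (coord d) p (X c p))"

definition one_form :: "('a, 'n::finite) chart set \<Rightarrow> ('a, 'n) field \<Rightarrow> bool" where
  "one_form A \<Upsilon> \<longleftrightarrow>
     (\<forall>c\<in>A. smooth_on (coord c ` dom_chart c) (in_chart c (\<Upsilon> c))) \<and>
     (\<forall>c\<in>A. \<forall>d\<in>A. \<forall>p\<in>dom_chart c \<inter> dom_chart d. \<forall>v.
        \<Upsilon> c p \<bullet> v = \<Upsilon> d p \<bullet> chart_deriv c (coord d) p v)"

definition add_field :: "('a, 'n::finite) field \<Rightarrow> ('a, 'n) field \<Rightarrow> ('a, 'n) field" where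
  "add_field X Y = (\<lambda>c p. X c p + Y c p)"

definition scale_field :: "('a \<Rightarrow> real) \<Rightarrow> ('a, 'n::finite) field \<Rightarrow> ('a, 'n) field" where
  "scale_field f X = (\<lambda>c p. f p *\<^sub>R X c p)"

definition lie_bracket :: "('a, 'n::finite) field \<Rightarrow> ('a, 'n) field \<Rightarrow> ('a, 'n) field" where
  "lie_bracket X Y = (\<lambda>c p. chart_deriv c (Y c) p (X c p) - chart_deriv c (X c) p (Y c p))"

section \<open>Affine connections\<close>

text \<open>\<open>D X Y\<close> is \<open>\<nabla>\<^sub>X Y\<close>, that is \<open>X\<^sup>a \<nabla>\<^sub>a Y\<^sup>b\<close>.\<close>

type_synonym ('a, 'n) connection = "('a, 'n) field \<Rightarrow> ('a, 'n) field \<Rightarrow> ('a, 'n) field"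

definition affine_connection :: "('a, 'n::finite) chart set \<Rightarrow> ('a, 'n) connection \<Rightarrow> bool" where
  "affine_connection A D \<longleftrightarrow>
     (\<forall>X Y. vector_field A X \<and> vector_field A Y \<longrightarrow> vector_field A (D X Y)) \<and>
     (\<forall>X X' Y. vector_field A X \<and> vector_field A X' \<and> vector_field A Y \<longrightarrow>
        D (add_field X X') Y = add_field (D X Y) (D X' Y)) \<and>
     (\<forall>X Y Y'. vector_field A X \<and> vector_field A Y \<and> vector_field A Y' \<longrightarrow>
        D X (add_field Y Y') = add_field (D X Y) (D X Y')) \<and>
     (\<forall>f X Y. smooth_function A f \<and> vector_field A X \<and> vector_field A Y \<longrightarrow>
        D (scale_field f X) Y = scale_field f (D X Y)) \<and>
     (\<forall>f X Y. smooth_function A f \<and> vector_field A X \<and> vector_field A Y \<longrightarrow>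
        (\<forall>c\<in>A. \<forall>p\<in>dom_chart c.
           D X (scale_field f Y) c p = f p *\<^sub>R D X Y c p + chart_deriv c f p (X c p) *\<^sub>R Y c p))"

definition torsion_free :: "('a, 'n::finite) chart set \<Rightarrow> ('a, 'n) connection \<Rightarrow> bool" where
  "torsion_free A D \<longleftrightarrow>
     (\<forall>X Y. vector_field A X \<and> vector_field A Y \<longrightarrow>
        (\<forall>c\<in>A. \<forall>p\<in>dom_chart c. D X Y c p - D Y X c p = lie_bracket X Y c p))"

text \<open>The second covariant derivative \<open>X\<^sup>a Y\<^sup>b \<nabla>\<^sub>a \<nabla>\<^sub>b Z\<^sup>c\<close>; the subtracted term comes from moving
  \<open>Y\<^sup>b\<close> out of \<open>X\<^sup>a \<nabla>\<^sub>a (Y\<^sup>b \<nabla>\<^sub>b Z\<^sup>c)\<close>.\<close>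

definition second_deriv ::
  "('a, 'n::finite) connection \<Rightarrow> ('a, 'n) field \<Rightarrow> ('a, 'n) field \<Rightarrow> ('a, 'n) field \<Rightarrow> ('a, 'n) field" where
  "second_deriv D X Y Z = (\<lambda>c p. D X (D Y Z) c p - D (D X Y) Z c p)"

text \<open>Components of a tensor at a point; \<open>R a b c d\<close> stands for \<open>R\<^sub>a\<^sub>b\<^sup>c\<^sub>d\<close>, so the third index is
  the upper one.\<close>

type_synonym 'n tensor2 = "'n \<Rightarrow> 'n \<Rightarrow> real"
type_synonym 'n tensor4 = "'n \<Rightarrow> 'n \<Rightarrow> 'n \<Rightarrow> 'n \<Rightarrow> real"

text \<open>The components at \<open>p\<close> in the chart \<open>c\<close> of the tensor with
  \<open>(\<nabla>\<^sub>a \<nabla>\<^sub>b - \<nabla>\<^sub>b \<nabla>\<^sub>a) Z\<^sup>c = R\<^sub>a\<^sub>b\<^sup>c\<^sub>d Z\<^sup>d\<close>.\<close>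

definition curvature ::
  "('a, 'n::finite) chart set \<Rightarrow> ('a, 'n) connection \<Rightarrow> ('a, 'n) chart \<Rightarrow> 'a \<Rightarrow> 'n tensor4" where
  "curvature A D c p = (THE R. \<forall>X Y Z. vector_field A X \<and> vector_field A Y \<and> vector_field A Z \<longrightarrow>
     (\<forall>i. (second_deriv D X Y Z c p - second_deriv D Y X Z c p) $ i =
        (\<Sum>a\<in>UNIV. \<Sum>b\<in>UNIV. \<Sum>d\<in>UNIV. R a b i d * X c p $ a * Y c p $ b * Z c p $ d)))"

section \<open>The decomposition of the curvature\<close>

definition delta :: "'n tensor2" where
  "delta c d = (if c = d then 1 else 0)"

definition ricci :: "'n::finite tensor4 \<Rightarrow> 'n tensor2" where
  "ricci R a b = (\<Sum>c\<in>UNIV. R c a c b)"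

definition totally_trace_free :: "'n::finite tensor4 \<Rightarrow> bool" where
  "totally_trace_free W \<longleftrightarrow>
     (\<forall>a b. (\<Sum>c\<in>UNIV. W c a c b) = 0) \<and>
     (\<forall>a b. (\<Sum>c\<in>UNIV. W a c c b) = 0) \<and>
     (\<forall>a b. (\<Sum>c\<in>UNIV. W a b c c) = 0)"

definition projective_decomposition ::
  "'n::finite tensor4 \<Rightarrow> 'n tensor4 \<Rightarrow> 'n tensor2 \<Rightarrow> 'n tensor2 \<Rightarrow> bool" where
  "projective_decomposition R W P \<beta> \<longleftrightarrow>
     (\<forall>a b c d. R a b c d = W a b c d + (delta c a * P b d - delta c b * P a d) + \<beta> a b * delta c d) \<and>
     (\<forall>a b. \<beta> a b = - (P a b - P b a)) \<and>
     totally_trace_free W"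

definition weyl :: "'n::finite tensor4 \<Rightarrow> 'n tensor4" where
  "weyl R = (THE W. \<exists>P \<beta>. projective_decomposition R W P \<beta>)"

definition schouten :: "'n::finite tensor4 \<Rightarrow> 'n tensor2" where
  "schouten R = (THE P. \<exists>W \<beta>. projective_decomposition R W P \<beta>)"

lemma delta_sums:
  fixes f :: "'n::finite \<Rightarrow> real"
  shows "(\<Sum>c\<in>UNIV. delta c a * f c) = f a" "(\<Sum>c\<in>UNIV. delta a c * f c) = f a"
    "(\<Sum>c\<in>UNIV. f c * delta c a) = f a" "(\<Sum>c\<in>UNIV. f c * delta a c) = f a"
    "delta c c = 1"
  by (simp_all add: delta_def if_distrib[of "\<lambda>x. x * _"] if_distrib[of "(*) _"] cong: if_cong)

lemma projective_decomposition_ricci: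
  fixes R W :: "'n::finite tensor4"
  assumes "projective_decomposition R W P \<beta>"
  shows "(real CARD('n) - 1) * P a b = ricci R a b + \<beta> a b"
proof -
  have "ricci R a b = (\<Sum>c\<in>UNIV. W c a c b) + (\<Sum>c\<in>(UNIV::'n set). delta c c * P a b)
      - (\<Sum>c\<in>UNIV. delta c a * P c b) + (\<Sum>c\<in>UNIV. \<beta> c a * delta c b)"
    using assms
    by (simp add: projective_decomposition_def ricci_def sum.distrib sum_subtractf)
  also have "\<dots> = (real CARD('n) - 1) * P a b - \<beta> a b"
    using assms
    by (simp add: delta_sums algebra_simps)
      (simp add: projective_decomposition_def totally_trace_free_def)
  finally show ?thesis by simp
qed

lemma projective_decomposition_unique:
  fixes R W :: "'n::finite tensor4"
  assumes n: "CARD('n) \<ge> 2" and dec: "projective_decomposition R W P \<beta>"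
  shows "P = (\<lambda>a b. (real CARD('n) * ricci R a b + ricci R b a) / ((real CARD('n))\<^sup>2 - 1))"
    "\<beta> = (\<lambda>a b. - (P a b - P b a))"
    "W = (\<lambda>a b c d. R a b c d - (delta c a * P b d - delta c b * P a d) - \<beta> a b * delta c d)"
proof -
  let ?n = "real CARD('n)"
  show b: "\<beta> = (\<lambda>a b. - (P a b - P b a))"
    using dec by (intro ext) (simp add: projective_decomposition_def)
  show "W = (\<lambda>a b c d. R a b c d - (delta c a * P b d - delta c b * P a d) - \<beta> a b * delta c d)"
    using dec by (intro ext) (simp add: projective_decomposition_def)
  have "?n\<^sup>2 > 1"
    using n by (intro one_less_power) auto
  then have nz: "?n\<^sup>2 - 1 \<noteq> 0" by simp
  have "P a b * (?n\<^sup>2 - 1) = ?n * ricci R a b + ricci R b a" for a b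
  proof -
    have 1: "ricci R a b = ?n * P a b - P b a" "ricci R b a = ?n * P b a - P a b"
      using projective_decomposition_ricci[OF dec, of a b] projective_decomposition_ricci[OF dec, of b a]
      unfolding b by (simp_all add: algebra_simps)
    show ?thesis unfolding 1 by (simp add: algebra_simps power2_eq_square)
  qed
  then show "P = (\<lambda>a b. (?n * ricci R a b + ricci R b a) / (?n\<^sup>2 - 1))"
    using nz by (simp add: fun_eq_iff eq_divide_eq)
qed

lemma projective_decomposition_exists:
  fixes R :: "'n::finite tensor4"
  assumes n: "CARD('n) \<ge> 2"
    and skew: "\<And>a b c d. R a b c d = - R b a c d"
    and bianchi: "\<And>a b c d. R a b c d + R b d c a + R d a c b = 0"
  obtains W P \<beta> where "projective_decomposition R W P \<beta>"
proof -
  let ?n = "real CARD('n)"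
  define P where "P = (\<lambda>a b. (?n * ricci R a b + ricci R b a) / (?n\<^sup>2 - 1))"
  define \<beta> where "\<beta> = (\<lambda>a b. - (P a b - P b a))"
  define W where "W = (\<lambda>a b c d. R a b c d - (delta c a * P b d - delta c b * P a d) - \<beta> a b * delta c d)"
  have "?n\<^sup>2 > 1"
    using n by (intro one_less_power) auto
  then have nz: "?n\<^sup>2 - 1 \<noteq> 0" by simp
  have ric: "ricci R a b = ?n * P a b - P b a" for a b
  proof -
    have "P a b * (?n\<^sup>2 - 1) = ?n * ricci R a b + ricci R b a"
      "P b a * (?n\<^sup>2 - 1) = ?n * ricci R b a + ricci R a b"
      using nz by (simp_all add: P_def)
    then have "(?n * P a b - P b a) * (?n\<^sup>2 - 1) = ricci R a b * (?n\<^sup>2 - 1)"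
      by algebra
    then show ?thesis using nz by simp
  qed
  have W1: "(\<Sum>c\<in>UNIV. W c a c b) = 0" for a b
  proof -
    have "(\<Sum>c\<in>UNIV. W c a c b) = ricci R a b - (\<Sum>c\<in>(UNIV::'n set). delta c c * P a b)
        + (\<Sum>c\<in>UNIV. delta c a * P c b) - (\<Sum>c\<in>UNIV. \<beta> c a * delta c b)"
      by (simp add: W_def ricci_def sum.distrib sum_subtractf)
    also have "\<dots> = 0"
      by (simp add: delta_sums) (simp add: ric \<beta>_def)
    finally show ?thesis .
  qed
  have W_skew: "W a c e b = - W c a e b" for a c e b
    using skew[of a c e b] by (simp add: W_def \<beta>_def algebra_simps)
  have W2: "(\<Sum>c\<in>UNIV. W a c c b) = 0" for a b
    using W1[of a b] by (subst W_skew) (simp add: sum_negf)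
  have W3: "(\<Sum>c\<in>UNIV. W a b c c) = 0" for a b
  proof -
    have "(\<Sum>c\<in>UNIV. R a b c c) = (\<Sum>c\<in>UNIV. R c b c a - R c a c b)"
    proof (intro sum.cong refl)
      fix c
      show "R a b c c = R c b c a - R c a c b"
        using bianchi[of a b c c] skew[of b c c a] by linarith
    qed
    then have "(\<Sum>c\<in>UNIV. R a b c c) = ricci R b a - ricci R a b"
      by (simp add: ricci_def sum_subtractf)
    moreover have "(\<Sum>c\<in>UNIV. W a b c c) = (\<Sum>c\<in>UNIV. R a b c c) - (\<Sum>c\<in>UNIV. delta c a * P b c)
        + (\<Sum>c\<in>UNIV. delta c b * P a c) - (\<Sum>c\<in>(UNIV::'n set). \<beta> a b * delta c c)"
      by (simp add: W_def sum.distrib sum_subtractf)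
    ultimately show ?thesis
      by (simp add: delta_sums) (simp add: ric \<beta>_def algebra_simps)
  qed
  have "projective_decomposition R W P \<beta>"
    using W1 W2 W3 by (auto simp: projective_decomposition_def totally_trace_free_def W_def \<beta>_def)
  then show ?thesis by (rule that)
qed

definition scale_connection :: "('a, 'n::finite) chart set \<Rightarrow> ('a, 'n) connection \<Rightarrow> bool" where
  "scale_connection A D \<longleftrightarrow> affine_connection A D \<and> torsion_free A D \<and>
     (\<forall>c\<in>A. \<forall>p\<in>dom_chart c. \<forall>a b. schouten (curvature A D c p) a b = schouten (curvature A D c p) b a)"

text \<open>\<open>\<nabla>'\<^sub>a Y\<^sup>b = \<nabla>\<^sub>a Y\<^sup>b + \<Upsilon>\<^sub>a Y\<^sup>b + \<Upsilon>\<^sub>c Y\<^sup>c \<delta>\<^sub>a\<^sup>b\<close>, contracted with an arbitrary \<open>X\<^sup>a\<close>.\<close>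

definition projectively_equivalent ::
  "('a, 'n::finite) chart set \<Rightarrow> ('a, 'n) connection \<Rightarrow> ('a, 'n) connection \<Rightarrow> bool" where
  "projectively_equivalent A D D' \<longleftrightarrow>
     (\<exists>\<Upsilon>. one_form A \<Upsilon> \<and>
        (\<forall>X Y. vector_field A X \<and> vector_field A Y \<longrightarrow>
           (\<forall>c\<in>A. \<forall>p\<in>dom_chart c.
              D' X Y c p = D X Y c p + (\<Upsilon> c p \<bullet> X c p) *\<^sub>R Y c p + (\<Upsilon> c p \<bullet> Y c p) *\<^sub>R X c p)))"

section \<open>Curvature forms\<close>

text \<open>Covariant tensors of rank \<open>m\<close> are functions of \<open>a\<^sub>0, \<dots>, a\<^sub>m\<^sub>-\<^sub>1\<close> (indices are numbered from 0).
  The antisymmetrisation is a projection, that is, it includes the factor \<open>1/m!\<close>.\<close>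

definition skew_part :: "nat \<Rightarrow> ((nat \<Rightarrow> 'n) \<Rightarrow> real) \<Rightarrow> (nat \<Rightarrow> 'n) \<Rightarrow> real" where
  "skew_part m T a = (\<Sum>\<sigma> | \<sigma> permutes {..<m}. of_int (sign \<sigma>) * T (a \<circ> \<sigma>)) / fact m"

text \<open>The contraction over \<open>c\<^sub>0, \<dots>, c\<^sub>k\<^sub>-\<^sub>1\<close> is cyclic: the last lower index is \<open>c\<^sub>0\<close>.\<close>

definition cyclic_trace :: "nat \<Rightarrow> 'n::finite tensor4 \<Rightarrow> (nat \<Rightarrow> 'n) \<Rightarrow> real" where
  "cyclic_trace k R a =
     (\<Sum>c \<in> {..<k} \<rightarrow>\<^sub>E UNIV. \<Prod>i<k. R (a (2 * i)) (a (2 * i + 1)) (c i) (c ((i + 1) mod k)))"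

definition curvature_form ::
  "nat \<Rightarrow> ('a, 'n::finite) chart set \<Rightarrow> ('a, 'n) connection \<Rightarrow> ('a, 'n) chart \<Rightarrow> 'a \<Rightarrow> (nat \<Rightarrow> 'n) \<Rightarrow> real" where
  "curvature_form k A D c p = skew_part (2 * k) (cyclic_trace k (curvature A D c p))"

end

(*
  Near a point of a chart c, multiplying by a bump function turns the coordinate fields of c into
  global vector fields.  Hence a connection is given near the point by Christoffel symbols, and its
  curvature by the classical formula in them; this yields the skew symmetry and the first Bianchi
  identity, and shows that a projective change adds to the curvature only terms of the shape removed
  in passing to the Weyl tensor.

  For the formula itself let R = W + Q with Q_ab^c_d = delta^c_a P_bd - delta^c_b P_ad and P
  symmetric.  In the skewed cyclic trace every factor Q contracts the lower index d of the preceding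
  factor with a delta, so that this index is skewed together with the first two indices of that
  factor.  All of R, W and Q satisfy the Bianchi identity, so every term containing a Q vanishes.
*)
theory Submission
  imports Defs
begin

section \<open>Functions of class \<open>C\<^sup>k\<close>\<close>

text \<open>A connection is an operator on global fields with no locality built in, and
  \<open>curvature\<close> is a definite description. So two facts must be earned before any formula
  applies: the value at a point depends only on the fields near it, and global fields realise every
  triple of tangent vectors there. The cut-off coordinate fields supply both. Extending them by zero
  is smooth because their support lies in a compact set, and compact sets are closed in a Hausdorff
  space.

  In the algebra R is exchanged for W one factor at a time. Each difference then contains exactly
  one Q, and for k > 1 the factor before it is an R or a W, never another Q. The Bianchi identity
  for W follows from those for R and Q, and for Q it is the symmetry of P. If k = 1 there is no
  preceding factor: Q is contracted with itself and gives P_ba - P_ab, which is 0.\<close>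

lemma Ck_on_cong:
  assumes "open S" "\<And>x. x \<in> S \<Longrightarrow> f x = g x" "Ck_on k f S"
  shows "Ck_on k g S"
  using assms(2,3)
proof (induction k arbitrary: f g)
  case 0
  then show ?case using continuous_on_cong[of S S f g] by simp
next
  case (Suc k)
  have diff: "f differentiable (at x)" if "x \<in> S" for x
    using Suc.prems that by simp
  have "g differentiable (at x)" if "x \<in> S" for x
  proof -
    have "(f has_derivative frechet_derivative f (at x)) (at x)"
      using diff[OF that] by (simp add: frechet_derivative_works)
    then have "(g has_derivative frechet_derivative f (at x)) (at x)"
      using assms(1) that Suc.prems(1) has_derivative_transform_within_open by blast
    then show ?thesis by (auto simp: differentiable_def)
  qed
  moreover have "Ck_on k (\<lambda>x. frechet_derivative g (at x) v) S" for v
  proof (rule Suc.IH)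
    show "Ck_on k (\<lambda>x. frechet_derivative f (at x) v) S" using Suc.prems by simp
    show "frechet_derivative f (at x) v = frechet_derivative g (at x) v" if "x \<in> S" for x
      using frechet_derivative_transform_within_open[OF diff[OF that] assms(1) that] Suc.prems(1)
      by metis
  qed
  ultimately show ?case by simp
qed

lemma Ck_on_subset:
  "Ck_on k f S \<Longrightarrow> T \<subseteq> S \<Longrightarrow> Ck_on k f T"
  by (induction k arbitrary: f) (auto intro: continuous_on_subset)

text \<open>Differentiability and the value of the derivative are conditions at single points, so
  the order of smoothness can be checked near each point; this glues smoothness over open
  covers.\<close>

lemma Ck_on_local:
  assumes "\<And>x. x \<in> S \<Longrightarrow> \<exists>T. open T \<and> x \<in> T \<and> Ck_on k f T"
  shows "Ck_on k f S"
  using assms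
proof (induction k arbitrary: f)
  case 0
  have "isCont f x" if "x \<in> S" for x
    using 0[OF that] by (auto simp: continuous_on_eq_continuous_at)
  then show ?case by (simp add: continuous_at_imp_continuous_on)
next
  case (Suc k)
  have "f differentiable (at x)" if "x \<in> S" for x
    using Suc.prems[OF that] by auto
  moreover have "Ck_on k (\<lambda>x. frechet_derivative f (at x) v) S" for v
    by (rule Suc.IH) (use Suc.prems in fastforce)
  ultimately show ?case by simp
qed

text \<open>The product and chain rules leave undifferentiated factors behind, and the inductions
  need these at the lower order.\<close>

lemma Ck_on_Suc_D: "Ck_on (Suc k) f S \<Longrightarrow> Ck_on k f S"
proof (induction k arbitrary: f)
  case 0
  then show ?case
    by (auto intro!: differentiable_imp_continuous_on differentiable_at_imp_differentiable_on)
next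
  case (Suc k)
  then show ?case by (metis Ck_on.simps(2))
qed

text \<open>A derivative obtained from the calculus rules may stand in for
  \<open>frechet_derivative\<close>, because the two agree throughout the open set
  \<open>S\<close>.\<close>

lemma Ck_on_SucI:
  assumes "open S"
    and "\<And>x. x \<in> S \<Longrightarrow> (f has_derivative f' x) (at x)"
    and "\<And>v. Ck_on k (\<lambda>x. f' x v) S"
  shows "Ck_on (Suc k) f S"
proof -
  have "f' x v = frechet_derivative f (at x) v" if "x \<in> S" for x v
    using frechet_derivative_at[OF assms(2)[OF that]] by simp
  then have "Ck_on k (\<lambda>x. frechet_derivative f (at x) v) S" for v
    by (rule Ck_on_cong[OF assms(1) _ assms(3)])
  moreover have "f differentiable (at x)" if "x \<in> S" for x
    using assms(2)[OF that] unfolding differentiable_def by blast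
  ultimately show ?thesis by simp
qed

lemma Ck_on_Suc_has_derivative:
  "Ck_on (Suc k) f S \<Longrightarrow> x \<in> S \<Longrightarrow> (f has_derivative frechet_derivative f (at x)) (at x)"
  by (simp add: frechet_derivative_works)

lemma Ck_on_const: "open S \<Longrightarrow> Ck_on k (\<lambda>x. c) S"
  by (induction k arbitrary: c) auto

lemma Ck_on_linear:
  assumes "bounded_linear L" "open S" "Ck_on k f S"
  shows "Ck_on k (\<lambda>x. L (f x)) S"
  using assms(3)
proof (induction k arbitrary: f)
  case 0
  then show ?case using assms(1) by (simp add: bounded_linear.continuous_on)
next
  case (Suc k)
  show ?case
  proof (rule Ck_on_SucI[OF assms(2)])
    show "((\<lambda>x. L (f x)) has_derivative (\<lambda>v. L (frechet_derivative f (at x) v))) (at x)"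
      if "x \<in> S" for x
      using bounded_linear.has_derivative[OF assms(1) Ck_on_Suc_has_derivative[OF Suc.prems that]] .
    show "Ck_on k (\<lambda>x. L (frechet_derivative f (at x) v)) S" for v
      using Suc by simp
  qed
qed

lemma Ck_on_ident: "open S \<Longrightarrow> Ck_on k (\<lambda>x. x) S"
  by (cases k) (auto intro: Ck_on_const)

lemma Ck_on_add:
  assumes "open S" "Ck_on k f S" "Ck_on k g S"
  shows "Ck_on k (\<lambda>x. f x + g x) S"
  using assms(2,3)
proof (induction k arbitrary: f g)
  case 0
  then show ?case by (simp add: continuous_on_add)
next
  case (Suc k)
  show ?case
    by (rule Ck_on_SucI[OF assms(1) has_derivative_add[OF Ck_on_Suc_has_derivative[OF Suc.prems(1)]
          Ck_on_Suc_has_derivative[OF Suc.prems(2)]]]) (use Suc in auto)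
qed

lemma Ck_on_sum:
  assumes "open S" "\<And>i. i \<in> I \<Longrightarrow> Ck_on k (f i) S"
  shows "Ck_on k (\<lambda>x. \<Sum>i\<in>I. f i x) S"
  using assms(2)
  by (induction I rule: infinite_finite_induct) (auto intro: Ck_on_add Ck_on_const assms(1))

lemma Ck_on_scaleR:
  fixes f :: "real^'n \<Rightarrow> real"
  assumes "open S" "Ck_on k f S" "Ck_on k g S"
  shows "Ck_on k (\<lambda>x. f x *\<^sub>R g x) S"
  using assms(2,3)
proof (induction k arbitrary: f g)
  case 0
  then show ?case by (simp add: continuous_on_scaleR)
next
  case (Suc k)
  show ?case
    by (rule Ck_on_SucI[OF assms(1) has_derivative_scaleR[OF Ck_on_Suc_has_derivative[OF Suc.prems(1)]
          Ck_on_Suc_has_derivative[OF Suc.prems(2)]]])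
      (use Suc Ck_on_Suc_D[OF Suc.prems(1)] Ck_on_Suc_D[OF Suc.prems(2)] in \<open>auto intro: Ck_on_add assms(1)\<close>)
qed

lemma linear_axis_expansion:
  fixes v :: "real^'n::finite"
  assumes "linear L"
  shows "L v = (\<Sum>j\<in>UNIV. (v $ j) *\<^sub>R L (axis j 1))"
proof -
  have "L v = L (\<Sum>j\<in>UNIV. (v $ j) *\<^sub>R axis j 1)"
    by (simp only: basis_expansion scalar_mult_eq_scaleR[symmetric])
  then show ?thesis
    using assms by (simp add: linear_sum linear_cmul o_def)
qed

text \<open>In the derivative of \<open>f\<close> at \<open>g x\<close> both the base point and the
  direction vary with \<open>x\<close>, which the induction hypothesis does not cover. Expanding the
  direction in the standard basis leaves derivatives in fixed directions, composed with
  \<open>g\<close>, times scalar functions.\<close>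

lemma Ck_on_compose:
  fixes f :: "real^'n::finite \<Rightarrow> 'b::real_normed_vector" and g :: "real^'n \<Rightarrow> real^'n"
  assumes "open S" "open T" "g ` S \<subseteq> T" "Ck_on k f T" "Ck_on k g S"
  shows "Ck_on k (\<lambda>x. f (g x)) S"
  using assms(4,5)
proof (induction k arbitrary: f)
  case 0
  then show ?case using assms(3) by (auto intro: continuous_on_compose2)
next
  case (Suc k)
  show ?case
  proof (rule Ck_on_SucI[OF assms(1)])
    show "((\<lambda>x. f (g x)) has_derivative
        (\<lambda>v. \<Sum>j\<in>UNIV. (frechet_derivative g (at x) v $ j) *\<^sub>R frechet_derivative f (at (g x)) (axis j 1))) (at x)"
      if "x \<in> S" for x
    proof -
      have f: "(f has_derivative frechet_derivative f (at (g x))) (at (g x))"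
        using Ck_on_Suc_has_derivative[OF Suc.prems(1), of "g x"] that assms(3) by auto
      have "((\<lambda>x. f (g x)) has_derivative
        (\<lambda>v. frechet_derivative f (at (g x)) (frechet_derivative g (at x) v))) (at x)"
        using has_derivative_compose[OF Ck_on_Suc_has_derivative[OF Suc.prems(2) that] f] by (simp add: o_def)
      then show ?thesis
        by (rule has_derivative_eq_rhs) (rule ext, rule linear_axis_expansion[OF has_derivative_linear[OF f]])
    qed
    show "Ck_on k (\<lambda>x. \<Sum>j\<in>UNIV. (frechet_derivative g (at x) v $ j) *\<^sub>R
        frechet_derivative f (at (g x)) (axis j 1)) S" for v
    proof (intro Ck_on_sum Ck_on_scaleR assms(1))
      show "Ck_on k (\<lambda>x. frechet_derivative g (at x) v $ j) S" for j
        by (rule Ck_on_linear[OF bounded_linear_vec_nth assms(1)]) (use Suc.prems(2) in simp)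
      show "Ck_on k (\<lambda>x. frechet_derivative f (at (g x)) (axis j 1)) S" for j
        by (rule Suc.IH[OF _ Ck_on_Suc_D[OF Suc.prems(2)]]) (use Suc.prems(1) in simp)
    qed
  qed
qed

section \<open>Smooth maps: the rules for all orders at once\<close>

lemma smooth_onI: "(\<And>k. Ck_on k f S) \<Longrightarrow> smooth_on S f"
  by (simp add: smooth_on_def)

lemma smooth_onD: "smooth_on S f \<Longrightarrow> Ck_on k f S"
  by (simp add: smooth_on_def)

lemma smooth_on_has_derivative:
  "smooth_on S f \<Longrightarrow> x \<in> S \<Longrightarrow> (f has_derivative frechet_derivative f (at x)) (at x)"
  using smooth_onD Ck_on_Suc_has_derivative by blast

lemma smooth_on_derivative:
  "smooth_on S f \<Longrightarrow> smooth_on S (\<lambda>x. frechet_derivative f (at x) v)"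
  by (metis Ck_on.simps(2) smooth_on_def)

lemma smooth_on_cong:
  "open S \<Longrightarrow> smooth_on S f \<Longrightarrow> (\<And>x. x \<in> S \<Longrightarrow> f x = g x) \<Longrightarrow> smooth_on S g"
  unfolding smooth_on_def using Ck_on_cong by blast

lemma smooth_on_subset: "smooth_on S f \<Longrightarrow> T \<subseteq> S \<Longrightarrow> smooth_on T f"
  unfolding smooth_on_def using Ck_on_subset by blast

lemma smooth_on_Un: "open S \<Longrightarrow> open T \<Longrightarrow> smooth_on S f \<Longrightarrow> smooth_on T f \<Longrightarrow> smooth_on (S \<union> T) f"
  unfolding smooth_on_def by (intro allI Ck_on_local) blast

lemma smooth_on_const: "open S \<Longrightarrow> smooth_on S (\<lambda>x. c)"
  by (simp add: smooth_on_def Ck_on_const)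

lemma smooth_on_linear:
  "bounded_linear L \<Longrightarrow> open S \<Longrightarrow> smooth_on S f \<Longrightarrow> smooth_on S (\<lambda>x. L (f x))"
  by (simp add: smooth_on_def Ck_on_linear)

lemma smooth_on_add:
  "open S \<Longrightarrow> smooth_on S f \<Longrightarrow> smooth_on S g \<Longrightarrow> smooth_on S (\<lambda>x. f x + g x)"
  by (simp add: smooth_on_def Ck_on_add)

lemma smooth_on_sum:
  "open S \<Longrightarrow> (\<And>i. i \<in> I \<Longrightarrow> smooth_on S (f i)) \<Longrightarrow> smooth_on S (\<lambda>x. \<Sum>i\<in>I. f i x)"
  by (simp add: smooth_on_def Ck_on_sum)

lemma smooth_on_scaleR:
  fixes f :: "real^'n \<Rightarrow> real"
  shows "open S \<Longrightarrow> smooth_on S f \<Longrightarrow> smooth_on S g \<Longrightarrow> smooth_on S (\<lambda>x. f x *\<^sub>R g x)"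
  by (simp add: smooth_on_def Ck_on_scaleR)

lemma smooth_on_compose:
  fixes f :: "real^'n::finite \<Rightarrow> 'b::real_normed_vector" and g :: "real^'n \<Rightarrow> real^'n"
  shows "open S \<Longrightarrow> open T \<Longrightarrow> g ` S \<subseteq> T \<Longrightarrow> smooth_on T f \<Longrightarrow> smooth_on S g \<Longrightarrow> smooth_on S (\<lambda>x. f (g x))"
  unfolding smooth_on_def using Ck_on_compose by blast

subsection \<open>Symmetry of second derivatives\<close>

text \<open>The mean value theorem is used twice: in direction \<open>u\<close> for the increment of
  \<open>f\<close> along \<open>t *\<^sub>R v\<close>, then in direction \<open>v\<close> for the
  resulting increment of \<open>f' _ u\<close>. The left side is symmetric in \<open>u\<close> and
  \<open>v\<close>, while the right side is one particular mixed derivative.\<close>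

lemma second_difference:
  fixes f :: "real^'n \<Rightarrow> real"
  assumes t: "t > 0"
    and S: "\<And>a b. 0 \<le> a \<Longrightarrow> a \<le> t \<Longrightarrow> 0 \<le> b \<Longrightarrow> b \<le> t \<Longrightarrow> x + a *\<^sub>R u + b *\<^sub>R v \<in> S"
    and f: "\<And>y. y \<in> S \<Longrightarrow> (f has_derivative f' y) (at y)"
    and f': "\<And>y. y \<in> S \<Longrightarrow> ((\<lambda>y. f' y u) has_derivative f'' y) (at y)"
  shows "\<exists>a b. 0 < a \<and> a < t \<and> 0 < b \<and> b < t \<and>
     f (x + t *\<^sub>R u + t *\<^sub>R v) - f (x + t *\<^sub>R u) - f (x + t *\<^sub>R v) + f x = t\<^sup>2 * f'' (x + a *\<^sub>R u + b *\<^sub>R v) v"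
proof -
  let ?\<phi> = "\<lambda>s. f (x + s *\<^sub>R u + t *\<^sub>R v) - f (x + s *\<^sub>R u)"
  have 1: "((\<lambda>s. f (x + s *\<^sub>R u + b *\<^sub>R v)) has_real_derivative f' (x + s *\<^sub>R u + b *\<^sub>R v) u) (at s)"
    if "0 \<le> s" "s \<le> t" "0 \<le> b" "b \<le> t" for s b
  proof -
    note d = f[OF S[OF that]]
    have "((\<lambda>s. x + s *\<^sub>R u + b *\<^sub>R v) has_derivative (\<lambda>s. s *\<^sub>R u)) (at s)"
      by (auto intro!: derivative_eq_intros)
    from has_derivative_compose[OF this d] show ?thesis
      using has_derivative_linear[OF d]
      by (simp add: has_field_derivative_def linear_cmul mult_commute_abs)
  qed
  have "\<exists>a. 0 < a \<and> a < t \<and> ?\<phi> t - ?\<phi> 0 = (t - 0) * (f' (x + a *\<^sub>R u + t *\<^sub>R v) u - f' (x + a *\<^sub>R u) u)"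
    using t 1[of _ t] 1[of _ 0] by (intro MVT2 DERIV_diff) auto
  then obtain a where a: "0 < a" "a < t"
    and eq: "?\<phi> t - ?\<phi> 0 = t * (f' (x + a *\<^sub>R u + t *\<^sub>R v) u - f' (x + a *\<^sub>R u) u)" by auto
  have 2: "((\<lambda>s. f' (x + a *\<^sub>R u + s *\<^sub>R v) u) has_real_derivative f'' (x + a *\<^sub>R u + s *\<^sub>R v) v) (at s)"
    if "0 \<le> s" "s \<le> t" for s
  proof -
    have d: "((\<lambda>y. f' y u) has_derivative f'' (x + a *\<^sub>R u + s *\<^sub>R v)) (at (x + a *\<^sub>R u + s *\<^sub>R v))"
      using a that by (intro f' S) auto
    have "((\<lambda>s. x + a *\<^sub>R u + s *\<^sub>R v) has_derivative (\<lambda>s. s *\<^sub>R v)) (at s)"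
      by (auto intro!: derivative_eq_intros)
    from has_derivative_compose[OF this d] show ?thesis
      using has_derivative_linear[OF d]
      by (simp add: has_field_derivative_def linear_cmul mult_commute_abs)
  qed
  have "\<exists>b. 0 < b \<and> b < t \<and> f' (x + a *\<^sub>R u + t *\<^sub>R v) u - f' (x + a *\<^sub>R u + 0 *\<^sub>R v) u =
      (t - 0) * f'' (x + a *\<^sub>R u + b *\<^sub>R v) v"
    using t 2 by (intro MVT2) auto
  then obtain b where "0 < b" "b < t"
    "f' (x + a *\<^sub>R u + t *\<^sub>R v) u - f' (x + a *\<^sub>R u) u = t * f'' (x + a *\<^sub>R u + b *\<^sub>R v) v" by auto
  then show ?thesis
    using a eq by (intro exI[of _ a] exI[of _ b]) (auto simp: power2_eq_square algebra_simps)
qed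

text \<open>Schwarz's theorem. Exchanging \<open>u\<close> and \<open>v\<close> does not change the
  second difference, so the two mixed derivatives take equal values at points as close to
  \<open>x\<close> as desired; continuity carries this to \<open>x\<close>.\<close>

lemma second_derivative_symmetric:
  fixes f :: "real^'n \<Rightarrow> real"
  assumes S: "open S" "x \<in> S" and f: "Ck_on 2 f S"
  shows "frechet_derivative (\<lambda>y. frechet_derivative f (at y) u) (at x) v =
    frechet_derivative (\<lambda>y. frechet_derivative f (at y) v) (at x) u"
proof -
  define g where "g u v = (\<lambda>z. frechet_derivative (\<lambda>y. frechet_derivative f (at y) u) (at z) v)" for u v
  have d1: "(f has_derivative frechet_derivative f (at y)) (at y)" if "y \<in> S" for y
    using f that Ck_on_Suc_has_derivative[of 1 f S] by (simp add: numeral_2_eq_2)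
  have d2: "((\<lambda>y. frechet_derivative f (at y) w) has_derivative
      frechet_derivative (\<lambda>y. frechet_derivative f (at y) w) (at y)) (at y)" if "y \<in> S" for y w
    using f that by (simp add: numeral_2_eq_2 frechet_derivative_works[symmetric])
  have cont: "isCont (g u v) x" for u v
    using f S by (simp add: numeral_2_eq_2 g_def continuous_on_eq_continuous_at)
  obtain r where r: "r > 0" "ball x r \<subseteq> S"
    using S openE by blast
  define K where "K = norm u + norm v + 1"
  have K: "K > 0" by (simp add: K_def add_nonneg_pos)
  have *: "\<bar>g u v x - g v u x\<bar> \<le> e" if e: "e > 0" for e
  proof -
    obtain d1 where d1': "d1 > 0" "\<And>y. dist y x < d1 \<Longrightarrow> dist (g u v y) (g u v x) < e / 2"
      using cont[of u v] e unfolding continuous_at_eps_delta by (metis half_gt_zero)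
    obtain d2 where d2': "d2 > 0" "\<And>y. dist y x < d2 \<Longrightarrow> dist (g v u y) (g v u x) < e / 2"
      using cont[of v u] e unfolding continuous_at_eps_delta by (metis half_gt_zero)
    define m where "m = min r (min d1 d2)"
    have m: "m > 0" using r d1' d2' by (simp add: m_def)
    \<comment> \<open>With this \<open>t\<close> every displacement in question has norm at most
      \<open>t * K\<close>, which is \<open>m / 2\<close>. The summand 1 in \<open>K\<close> avoids
      division by zero when \<open>u\<close> and \<open>v\<close> both vanish.\<close>
    define t where "t = m / (2 * K)"
    have t: "t > 0" using m K by (simp add: t_def)
    have near: "norm (a *\<^sub>R u + b *\<^sub>R v) < m" if "0 \<le> a" "a \<le> t" "0 \<le> b" "b \<le> t" for a b
    proof -
      have "norm (a *\<^sub>R u + b *\<^sub>R v) \<le> a * norm u + b * norm v"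
        using that norm_triangle_ineq[of "a *\<^sub>R u" "b *\<^sub>R v"] by simp
      also have "\<dots> \<le> t * norm u + t * norm v"
        using that by (intro add_mono mult_right_mono) auto
      also have "\<dots> \<le> t * K" using t by (simp add: K_def algebra_simps)
      also have "\<dots> < m" using K m by (simp add: t_def field_simps)
      finally show ?thesis .
    qed
    have nd: "dist (x + a *\<^sub>R u + b *\<^sub>R v) x < m" if "0 \<le> a" "a \<le> t" "0 \<le> b" "b \<le> t" for a b
      using near[OF that] by (simp add: dist_norm add.assoc)
    have inS: "x + a *\<^sub>R u + b *\<^sub>R v \<in> S" if "0 \<le> a" "a \<le> t" "0 \<le> b" "b \<le> t" for a b
      using nd[OF that] r(2) by (auto simp: m_def dist_commute subset_iff)
    have inS': "x + a *\<^sub>R v + b *\<^sub>R u \<in> S" if "0 \<le> a" "a \<le> t" "0 \<le> b" "b \<le> t" for a b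
      using inS[of b a] that by (simp add: algebra_simps)
    obtain a b where ab: "0 < a" "a < t" "0 < b" "b < t"
      "f (x + t *\<^sub>R u + t *\<^sub>R v) - f (x + t *\<^sub>R u) - f (x + t *\<^sub>R v) + f x = t\<^sup>2 * g u v (x + a *\<^sub>R u + b *\<^sub>R v)"
      using second_difference[OF t inS d1 d2] unfolding g_def by blast
    obtain a' b' where ab': "0 < a'" "a' < t" "0 < b'" "b' < t"
      "f (x + t *\<^sub>R v + t *\<^sub>R u) - f (x + t *\<^sub>R v) - f (x + t *\<^sub>R u) + f x = t\<^sup>2 * g v u (x + a' *\<^sub>R v + b' *\<^sub>R u)"
      using second_difference[OF t inS' d1 d2] unfolding g_def by blast
    have "x + t *\<^sub>R v + t *\<^sub>R u = x + t *\<^sub>R u + t *\<^sub>R v" by (simp add: algebra_simps)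
    with ab(5) ab'(5) have "t\<^sup>2 * g u v (x + a *\<^sub>R u + b *\<^sub>R v) = t\<^sup>2 * g v u (x + a' *\<^sub>R v + b' *\<^sub>R u)"
      by (simp only:)
    then have eq: "g u v (x + a *\<^sub>R u + b *\<^sub>R v) = g v u (x + a' *\<^sub>R v + b' *\<^sub>R u)"
      using t by simp
    have "dist (x + a *\<^sub>R u + b *\<^sub>R v) x < d1"
      using nd[of a b] ab by (simp add: m_def)
    moreover have "dist (x + a' *\<^sub>R v + b' *\<^sub>R u) x < d2"
      using nd[of b' a'] ab' by (simp add: m_def algebra_simps)
    ultimately have "dist (g u v (x + a *\<^sub>R u + b *\<^sub>R v)) (g u v x) < e / 2"
      "dist (g v u (x + a' *\<^sub>R v + b' *\<^sub>R u)) (g v u x) < e / 2"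
      using d1' d2' by blast+
    then show ?thesis unfolding eq dist_real_def by argo
  qed
  have "\<bar>g u v x - g v u x\<bar> \<le> 0"
    by (rule field_le_epsilon) (use * in auto)
  then show ?thesis by (simp add: g_def)
qed

subsection \<open>Bump functions\<close>

text \<open>The powers of \<open>t\<close> in the denominator make the family closed under
  differentiation up to linear combinations, so smoothness follows by one induction for all
  \<open>m\<close> together.\<close>

definition flat :: "nat \<Rightarrow> real \<Rightarrow> real" where
  "flat m t = (if t > 0 then exp (- 1 / t) / t ^ m else 0)"

lemma flat_tendsto_0: "(flat m \<longlongrightarrow> 0) (at 0)"
proof -
  have "((\<lambda>t. inverse t ^ m / exp (inverse t)) \<longlongrightarrow> (0::real)) (at_right 0)"
    by (rule filterlim_compose[OF tendsto_power_div_exp_0 filterlim_inverse_at_top_right])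
  then have "(flat m \<longlongrightarrow> 0) (at_right 0)"
    by (rule Lim_transform_eventually)
      (auto simp: eventually_at_filter flat_def exp_minus field_simps)
  moreover have "(flat m \<longlongrightarrow> 0) (at_left 0)"
    by (rule Lim_transform_eventually[OF tendsto_const])
      (auto simp: eventually_at_filter flat_def)
  ultimately show ?thesis by (simp add: filterlim_split_at)
qed

lemma flat_has_derivative:
  "(flat m has_real_derivative flat (m + 2) t - real m * flat (m + 1) t) (at t)"
proof (cases t "0::real" rule: linorder_cases)
  case less
  have "((\<lambda>_. 0) has_real_derivative flat (m + 2) t - real m * flat (m + 1) t) (at t)"
    using less by (simp add: flat_def)
  then show ?thesis
    by (rule has_field_derivative_transform_within_open[of _ _ _ "{..<0}"])
      (use less in \<open>auto simp: flat_def\<close>)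
next
  case equal
  \<comment> \<open>The difference quotient of \<open>flat m\<close> at 0 is
    \<open>flat (m + 1)\<close>, whose limit is already known.\<close>
  have "((\<lambda>h. (flat m (0 + h) - flat m 0) / h) \<longlongrightarrow> 0) (at 0)"
    by (rule Lim_transform_eventually[OF flat_tendsto_0[of "m + 1"]])
      (auto simp: eventually_at_filter flat_def)
  then show ?thesis
    using equal by (simp add: DERIV_def flat_def)
next
  case greater
  have "((\<lambda>t. exp (- 1 / t) / t ^ m) has_real_derivative
      (exp (- 1 / t) * (1 / t\<^sup>2) * t ^ m - exp (- 1 / t) * (real m * t ^ (m - 1))) / (t ^ m * t ^ m)) (at t)"
    using greater by (auto intro!: derivative_eq_intros simp: power2_eq_square)
  moreover have "(exp (- 1 / t) * (1 / t\<^sup>2) * t ^ m - exp (- 1 / t) * (real m * t ^ (m - 1))) / (t ^ m * t ^ m) =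
      flat (m + 2) t - real m * flat (m + 1) t"
    using greater by (cases m) (auto simp: flat_def field_simps power2_eq_square)
  ultimately have "((\<lambda>t. exp (- 1 / t) / t ^ m) has_real_derivative
      flat (m + 2) t - real m * flat (m + 1) t) (at t)"
    by simp
  then show ?thesis
    by (rule has_field_derivative_transform_within_open[of _ _ _ "{0<..}"])
      (use greater in \<open>auto simp: flat_def\<close>)
qed

lemma flat_0_mono:
  assumes "0 < s" "s \<le> t"
  shows "flat 0 s \<le> flat 0 t"
proof -
  have "1 / t \<le> 1 / s" using assms by (simp add: frac_le)
  with assms show ?thesis by (simp add: flat_def)
qed

lemma Ck_on_flat:
  assumes "open S" "Ck_on k g S"
  shows "Ck_on k (\<lambda>x. flat m (g x)) S"
  using assms(2)
proof (induction k arbitrary: m)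
  case 0
  have "continuous_on UNIV (flat m)"
    using flat_has_derivative DERIV_isCont by (blast intro: continuous_at_imp_continuous_on)
  with 0 show ?case by (auto intro: continuous_on_compose2)
next
  case (Suc k)
  show ?case
  proof (rule Ck_on_SucI[OF assms(1)])
    show "((\<lambda>x. flat m (g x)) has_derivative (\<lambda>v. (flat (m + 2) (g x) + (- real m) *\<^sub>R flat (m + 1) (g x)) *\<^sub>R
        frechet_derivative g (at x) v)) (at x)" if "x \<in> S" for x
      using has_derivative_compose[OF Ck_on_Suc_has_derivative[OF Suc.prems that]
          flat_has_derivative[of m, unfolded has_field_derivative_def]]
      by simp
    show "Ck_on k (\<lambda>x. (flat (m + 2) (g x) + (- real m) *\<^sub>R flat (m + 1) (g x)) *\<^sub>R
        frechet_derivative g (at x) v) S" for v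
      by (intro Ck_on_scaleR Ck_on_add Ck_on_const assms(1) Suc.IH Ck_on_Suc_D[OF Suc.prems])
        (use Suc.prems in simp)
  qed
qed

lemma smooth_on_flat: "open S \<Longrightarrow> smooth_on S g \<Longrightarrow> smooth_on S (\<lambda>x. flat m (g x))"
  by (simp add: smooth_on_def Ck_on_flat)

lemma smooth_on_norm_square:
  fixes z :: "real^'n::finite"
  shows "smooth_on UNIV (\<lambda>x. (norm (x - z))\<^sup>2)"
proof -
  have c: "smooth_on UNIV (\<lambda>x. (x - z) $ i)" for i
  proof (rule smooth_on_linear[OF bounded_linear_vec_nth open_UNIV])
    show "smooth_on UNIV (\<lambda>x. x - z)"
      using smooth_on_add[OF open_UNIV smooth_onI[OF Ck_on_ident[OF open_UNIV]]
          smooth_on_const[OF open_UNIV, of "- z"]] by simp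
  qed
  have "smooth_on UNIV (\<lambda>x. \<Sum>i\<in>UNIV. ((x - z) $ i) *\<^sub>R ((x - z) $ i))"
    by (intro smooth_on_sum smooth_on_scaleR c open_UNIV)
  moreover have "(norm (x - z))\<^sup>2 = (\<Sum>i\<in>UNIV. ((x - z) $ i) *\<^sub>R ((x - z) $ i))" for x
    by (simp add: power2_norm_eq_inner inner_vec_def)
  ultimately show ?thesis by simp
qed

lemma bump_function:
  fixes z :: "real^'n::finite"
  assumes "r > 0"
  obtains b :: "real^'n \<Rightarrow> real" where "smooth_on UNIV b" "\<And>x. x \<in> ball z (r / 2) \<Longrightarrow> b x = 1"
    "\<And>x. x \<notin> ball z r \<Longrightarrow> b x = 0"
proof -
  \<comment> \<open>\<open>?s\<close> vanishes off the ball of radius \<open>r\<close> and is at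
    least 1 on the half ball, where the argument of \<open>flat 0\<close> is at least
    \<open>r\<^sup>2 / 2\<close>. The outer \<open>flat 0\<close> turns "at least 1" into the
    constant 1, and \<open>?d\<close> makes the value 0 where \<open>?s\<close> vanishes. Dividing
    only by constants avoids a quotient rule.\<close>
  let ?c = "inverse (flat 0 (r\<^sup>2 / 2))" and ?d = "inverse (flat 0 1)"
  let ?s = "\<lambda>x. ?c *\<^sub>R flat 0 (r\<^sup>2 + (- 1) *\<^sub>R (norm (x - z))\<^sup>2)"
  let ?b = "\<lambda>x. 1 + (- ?d) *\<^sub>R flat 0 (1 + (- 1) *\<^sub>R ?s x)"
  have "smooth_on UNIV ?b"
    by (intro smooth_on_add smooth_on_scaleR smooth_on_flat smooth_on_const open_UNIV smooth_on_norm_square)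
  moreover have "?b x = 1" if "x \<in> ball z (r / 2)" for x
  proof -
    have "norm (x - z) \<le> r / 2"
      using that by (simp add: dist_norm norm_minus_commute)
    then have "(norm (x - z))\<^sup>2 \<le> (r / 2)\<^sup>2"
      by (intro power_mono) auto
    then have "r\<^sup>2 / 2 \<le> r\<^sup>2 - (norm (x - z))\<^sup>2"
      by (simp add: power_divide) (use zero_le_power2[of r] in linarith)
    moreover have pos: "r\<^sup>2 / 2 > 0" using assms by simp
    ultimately have "flat 0 (r\<^sup>2 / 2) \<le> flat 0 (r\<^sup>2 - (norm (x - z))\<^sup>2)"
      by (intro flat_0_mono)
    moreover have "0 < flat 0 (r\<^sup>2 / 2)" using pos by (simp add: flat_def)
    ultimately
    have "?s x \<ge> 1" by (simp add: field_simps)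
    then show ?thesis by (simp add: flat_def)
  qed
  moreover have "?b x = 0" if "x \<notin> ball z r" for x
  proof -
    have "r \<le> norm (x - z)"
      using that by (simp add: dist_norm norm_minus_commute)
    then have "r\<^sup>2 \<le> (norm (x - z))\<^sup>2"
      using assms by (intro power_mono) auto
    then have s0: "?s x = 0" by (simp add: flat_def)
    show ?thesis unfolding s0 by (simp add: flat_def)
  qed
  ultimately show ?thesis by (rule that)
qed

section \<open>Fields on a manifold\<close>

locale manifold =
  fixes M :: "'a topology" and A :: "('a, 'n::finite) chart set"
  assumes smooth_manifold: "smooth_manifold M A"
begin

lemma openin_dom: "c \<in> A \<Longrightarrow> openin M (dom_chart c)"
  using smooth_manifold by (simp add: smooth_manifold_def)

lemma dom_subset_topspace: "c \<in> A \<Longrightarrow> dom_chart c \<subseteq> topspace M"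
  using openin_dom openin_subset by blast

lemma homeomorphic_coord:
  "c \<in> A \<Longrightarrow> homeomorphic_map (subtopology M (dom_chart c)) (top_of_set (coord c ` dom_chart c)) (coord c)"
  using smooth_manifold by (simp add: smooth_manifold_def)

lemma inj_coord:
  assumes "c \<in> A"
  shows "inj_on (coord c) (dom_chart c)"
  using homeomorphic_imp_injective_map[OF homeomorphic_coord[OF assms]] dom_subset_topspace[OF assms]
  by (simp add: Int_absorb1 inf_commute)

lemma open_coord_image:
  assumes "c \<in> A" "openin M W" "W \<subseteq> dom_chart c"
  shows "open (coord c ` W)"
proof -
  have "openin (subtopology M (dom_chart c)) W"
    using assms(2,3) by (simp add: openin_open_Int openin_subset_topspace_eq openin_subtopology) blast
  then have "openin (top_of_set (coord c ` dom_chart c)) (coord c ` W)"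
    using homeomorphic_imp_open_map[OF homeomorphic_coord[OF assms(1)]] by (auto simp: open_map_def)
  moreover have "open (coord c ` dom_chart c)"
    using smooth_manifold assms(1) by (simp add: smooth_manifold_def)
  ultimately show ?thesis by (simp add: openin_open_eq)
qed

lemma in_chart_coord: "c \<in> A \<Longrightarrow> p \<in> dom_chart c \<Longrightarrow> in_chart c f (coord c p) = f p"
  by (simp add: in_chart_def inv_into_f_f inj_coord)

lemma smooth_transition:
  "c \<in> A \<Longrightarrow> d \<in> A \<Longrightarrow> smooth_on (coord c ` (dom_chart c \<inter> dom_chart d)) (in_chart c (coord d))"
  using smooth_manifold by (simp add: smooth_manifold_def)

lemma in_chart_transition:
  assumes "c \<in> A" "d \<in> A" "x \<in> coord d ` (dom_chart c \<inter> dom_chart d)"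
  shows "in_chart d f x = in_chart c f (in_chart d (coord c) x)"
  using assms by (auto simp: in_chart_coord)

lemma smooth_on_change_chart:
  assumes "c \<in> A" "d \<in> A" "openin M W" "W \<subseteq> dom_chart c" "W \<subseteq> dom_chart d"
    and "smooth_on (coord c ` W) (in_chart c f)"
  shows "smooth_on (coord d ` W) (in_chart d f)"
proof -
  have o: "open (coord c ` W)" "open (coord d ` W)"
    using assms open_coord_image by blast+
  have "smooth_on (coord d ` W) (\<lambda>x. in_chart c f (in_chart d (coord c) x))"
  proof (rule smooth_on_compose[OF o(2) o(1) _ assms(6)])
    show "in_chart d (coord c) ` coord d ` W \<subseteq> coord c ` W"
      using assms by (auto simp: in_chart_coord subset_iff)
    show "smooth_on (coord d ` W) (in_chart d (coord c))"
      using assms by (intro smooth_on_subset[OF smooth_transition]) auto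
  qed
  then show ?thesis
  proof (rule smooth_on_cong[OF o(2)])
    show "in_chart c f (in_chart d (coord c) x) = in_chart d f x" if "x \<in> coord d ` W" for x
      using that assms by (intro in_chart_transition[symmetric]) auto
  qed
qed

text \<open>The chain rule for the transition map from \<open>d\<close> to \<open>c\<close>; it
  yields the transformation law of the coordinate fields.\<close>

lemma chart_deriv_change_chart:
  assumes "c \<in> A" "d \<in> A" "p \<in> dom_chart c" "p \<in> dom_chart d"
    and "in_chart c f differentiable (at (coord c p))"
  shows "chart_deriv d f p v = chart_deriv c f p (chart_deriv d (coord c) p v)"
proof -
  have p: "coord d p \<in> coord d ` (dom_chart d \<inter> dom_chart c)" using assms by auto
  have 1: "(in_chart d (coord c) has_derivative frechet_derivative (in_chart d (coord c)) (at (coord d p)))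
      (at (coord d p))"
    by (rule smooth_on_has_derivative[OF smooth_transition p]) (use assms in auto)
  have 2: "(in_chart c f has_derivative frechet_derivative (in_chart c f) (at (coord c p)))
      (at (in_chart d (coord c) (coord d p)))"
    using assms by (simp add: frechet_derivative_works in_chart_coord)
  have "(in_chart d f has_derivative (\<lambda>v. frechet_derivative (in_chart c f) (at (coord c p))
      (frechet_derivative (in_chart d (coord c)) (at (coord d p)) v))) (at (coord d p))"
    using has_derivative_compose[OF 1 2]
  proof (rule has_derivative_transform_within_open[OF _ _ p])
    show "open (coord d ` (dom_chart d \<inter> dom_chart c))"
      using assms openin_dom by (intro open_coord_image openin_Int) auto
    show "in_chart c f (in_chart d (coord c) x) = in_chart d f x"
      if "x \<in> coord d ` (dom_chart d \<inter> dom_chart c)" for x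
      using that assms by (intro in_chart_transition[symmetric]) auto
  qed
  from frechet_derivative_at[OF this, symmetric] show ?thesis
    by (simp add: chart_deriv_def)
qed

lemma chart_deriv_cong:
  assumes "c \<in> A" "openin M W" "W \<subseteq> dom_chart c" "p \<in> W" "\<And>q. q \<in> W \<Longrightarrow> f q = g q"
    and "in_chart c f differentiable (at (coord c p))"
  shows "chart_deriv c f p = chart_deriv c g p"
  unfolding chart_deriv_def
  by (subst frechet_derivative_transform_within_open[OF assms(6) open_coord_image[OF assms(1-3)],
        of "in_chart c g"])
    (use assms in \<open>auto simp: in_chart_coord subset_iff\<close>)

lemma chart_deriv_const_near:
  assumes "c \<in> A" "openin M W" "W \<subseteq> dom_chart c" "p \<in> W" "\<And>q. q \<in> W \<Longrightarrow> f q = k"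
  shows "chart_deriv c f p = (\<lambda>v. 0)"
proof -
  have "(in_chart c f has_derivative (\<lambda>v. 0)) (at (coord c p))"
    using has_derivative_const[of k]
    by (rule has_derivative_transform_within_open[OF _ open_coord_image[OF assms(1-3)]])
      (use assms in \<open>auto simp: in_chart_coord subset_iff\<close>)
  from frechet_derivative_at[OF this, symmetric] show ?thesis
    by (simp add: chart_deriv_def[abs_def])
qed

lemma chart_deriv_coord:
  assumes "c \<in> A" "p \<in> dom_chart c"
  shows "chart_deriv c (coord c) p v = v"
proof -
  have "(in_chart c (coord c) has_derivative (\<lambda>v. v)) (at (coord c p))"
    using has_derivative_ident
    by (rule has_derivative_transform_within_open[OF _ open_coord_image[OF assms(1) openin_dom[OF assms(1)]]])
      (use assms in \<open>auto simp: in_chart_coord\<close>)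
  from frechet_derivative_at[OF this, symmetric] show ?thesis
    by (simp add: chart_deriv_def)
qed

lemma linear_chart_deriv_coord:
  assumes "c \<in> A" "d \<in> A" "p \<in> dom_chart c" "p \<in> dom_chart d"
  shows "linear (chart_deriv c (coord d) p)"
proof -
  have "(in_chart c (coord d) has_derivative frechet_derivative (in_chart c (coord d)) (at (coord c p))) (at (coord c p))"
    by (rule smooth_on_has_derivative[OF smooth_transition]) (use assms in auto)
  then have "linear (frechet_derivative (in_chart c (coord d)) (at (coord c p)))"
    by (rule has_derivative_linear)
  then show ?thesis
    by (simp add: chart_deriv_def[abs_def])
qed

text \<open>The domain of \<open>d\<close> is covered by its overlap with the domain of
  \<open>c\<close> and by the complement of \<open>K\<close>, where \<open>f\<close> is zero. Both
  pieces are open, the second because \<open>K\<close> is closed in the whole of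
  \<open>M\<close>.\<close>

lemma smooth_extension:
  fixes f :: "'a \<Rightarrow> 'b::real_normed_vector"
  assumes c: "c \<in> A" and d: "d \<in> A" and K: "closedin M K" "K \<subseteq> dom_chart c"
    and f0: "\<And>p. p \<in> dom_chart d \<Longrightarrow> p \<notin> K \<Longrightarrow> f p = 0"
    and f: "smooth_on (coord c ` (dom_chart c \<inter> dom_chart d)) (in_chart c f)"
  shows "smooth_on (coord d ` dom_chart d) (in_chart d f)"
proof -
  let ?S = "coord d ` (dom_chart c \<inter> dom_chart d)" and ?T = "coord d ` (dom_chart d - K)"
  have "openin M (dom_chart c \<inter> dom_chart d)" "openin M (dom_chart d - K)"
    using openin_dom[OF c] openin_dom[OF d] K(1) by (simp_all add: openin_diff openin_Int)
  then have o: "open ?S" "open ?T"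
    using open_coord_image[OF d] by auto
  have "smooth_on ?S (in_chart d f)"
    by (rule smooth_on_change_chart[OF c d _ _ _ f]) (auto intro: openin_Int openin_dom[OF c] openin_dom[OF d])
  moreover have "smooth_on ?T (in_chart d f)"
    by (rule smooth_on_cong[OF o(2) smooth_on_const[OF o(2), of 0]])
      (use d f0 in \<open>auto simp: in_chart_coord\<close>)
  ultimately have "smooth_on (?S \<union> ?T) (in_chart d f)"
    using o by (intro smooth_on_Un)
  moreover have "?S \<union> ?T = coord d ` dom_chart d" using K(2) by auto
  ultimately show ?thesis by simp
qed

section \<open>Vector fields as a module over the smooth functions\<close>

lemma vector_fieldI:
  assumes "\<And>c p. c \<notin> A \<or> p \<notin> dom_chart c \<Longrightarrow> X c p = 0"
    and "\<And>c. c \<in> A \<Longrightarrow> smooth_on (coord c ` dom_chart c) (in_chart c (X c))"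
    and "\<And>c d p. c \<in> A \<Longrightarrow> d \<in> A \<Longrightarrow> p \<in> dom_chart c \<Longrightarrow> p \<in> dom_chart d \<Longrightarrow>
      X d p = chart_deriv c (coord d) p (X c p)"
  shows "vector_field A X"
  unfolding vector_field_def using assms by blast

lemma vector_field_outside: "vector_field A X \<Longrightarrow> c \<notin> A \<or> p \<notin> dom_chart c \<Longrightarrow> X c p = 0"
  unfolding vector_field_def by blast

lemma vector_field_transform:
  "vector_field A X \<Longrightarrow> c \<in> A \<Longrightarrow> d \<in> A \<Longrightarrow> p \<in> dom_chart c \<Longrightarrow> p \<in> dom_chart d \<Longrightarrow>
    X d p = chart_deriv c (coord d) p (X c p)"
  unfolding vector_field_def by blast

lemma vector_field_smooth:
  "vector_field A X \<Longrightarrow> c \<in> A \<Longrightarrow> smooth_on (coord c ` dom_chart c) (in_chart c (X c))"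
  unfolding vector_field_def by blast

text \<open>Fields vanish by convention where components carry no information. Equality as functions
  is needed in order to substitute one field for another inside a connection.\<close>

lemma vector_field_eqI:
  assumes "vector_field A X" "vector_field A Y"
    and "\<And>c p. c \<in> A \<Longrightarrow> p \<in> dom_chart c \<Longrightarrow> X c p = Y c p"
  shows "X = Y"
proof (intro ext)
  show "X c p = Y c p" for c p
    by (cases "c \<in> A \<and> p \<in> dom_chart c")
      (use assms vector_field_outside[of X c p] vector_field_outside[of Y c p] in auto)
qed

lemma open_chart_image: "c \<in> A \<Longrightarrow> open (coord c ` dom_chart c)"
  using open_coord_image openin_dom by blast

lemma vector_field_zero: "vector_field A (\<lambda>c p. 0)"
proof (rule vector_fieldI)
  show "smooth_on (coord c ` dom_chart c) (in_chart c (\<lambda>p. 0))" if "c \<in> A" for c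
    using smooth_on_const[OF open_chart_image[OF that], of 0] by (simp add: in_chart_def comp_def)
qed (simp_all add: linear_chart_deriv_coord linear_0)

lemma vector_field_add:
  assumes X: "vector_field A X" and Y: "vector_field A Y"
  shows "vector_field A (add_field X Y)"
proof (rule vector_fieldI)
  show "smooth_on (coord c ` dom_chart c) (in_chart c (add_field X Y c))" if "c \<in> A" for c
    using smooth_on_add[OF open_chart_image[OF that] vector_field_smooth[OF X that] vector_field_smooth[OF Y that]]
    by (simp add: in_chart_def comp_def add_field_def)
  show "add_field X Y d p = chart_deriv c (coord d) p (add_field X Y c p)"
    if "c \<in> A" "d \<in> A" "p \<in> dom_chart c" "p \<in> dom_chart d" for c d p
    using vector_field_transform[OF X that] vector_field_transform[OF Y that]
    by (simp add: linear_chart_deriv_coord that linear_add add_field_def)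
qed (use vector_field_outside[OF X] vector_field_outside[OF Y] in \<open>auto simp: add_field_def\<close>)

lemma vector_field_scale:
  assumes f: "smooth_function A f" and X: "vector_field A X"
  shows "vector_field A (scale_field f X)"
proof (rule vector_fieldI)
  show "smooth_on (coord c ` dom_chart c) (in_chart c (scale_field f X c))" if "c \<in> A" for c
    using smooth_on_scaleR[OF open_chart_image[OF that] _ vector_field_smooth[OF X that], of "in_chart c f"] f that
    by (simp add: in_chart_def comp_def scale_field_def smooth_function_def)
  show "scale_field f X d p = chart_deriv c (coord d) p (scale_field f X c p)"
    if "c \<in> A" "d \<in> A" "p \<in> dom_chart c" "p \<in> dom_chart d" for c d p
    using vector_field_transform[OF X that]
    by (simp add: linear_chart_deriv_coord that linear_cmul scale_field_def)
qed (use vector_field_outside[OF X] in \<open>auto simp: scale_field_def\<close>)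

lemma vector_field_sum:
  assumes "\<And>i. i \<in> I \<Longrightarrow> vector_field A (F i)"
  shows "vector_field A (\<lambda>c p. \<Sum>i\<in>I. F i c p)"
  using assms
proof (induction I rule: infinite_finite_induct)
  case (insert i I)
  then show ?case
    using vector_field_add[of "F i" "\<lambda>c p. \<Sum>i\<in>I. F i c p"] by (simp add: add_field_def)
qed (simp_all add: vector_field_zero)

lemma smooth_function_mult:
  assumes "smooth_function A f" "smooth_function A g"
  shows "smooth_function A (\<lambda>p. f p * g p)"
  unfolding smooth_function_def
proof
  fix c assume "c \<in> A"
  then show "smooth_on (coord c ` dom_chart c) (in_chart c (\<lambda>p. f p * g p))"
    using smooth_on_scaleR[OF open_chart_image, of c "in_chart c f" "in_chart c g"] assms
    by (simp add: in_chart_def comp_def smooth_function_def)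
qed

text \<open>\<open>K\<close> and \<open>N\<close> are the preimages of a closed ball and of the
  concentric open ball of half the radius. \<open>K\<close> is compact, being homeomorphic to its
  ball, hence closed in the Hausdorff space \<open>M\<close>; this is what extension by zero
  requires.\<close>

lemma cutoff_function:
  assumes c: "c \<in> A" and p: "p \<in> dom_chart c"
  obtains \<rho> K N where "closedin M K" "K \<subseteq> dom_chart c" "openin M N" "p \<in> N" "N \<subseteq> dom_chart c"
    "smooth_on (coord c ` dom_chart c) (in_chart c \<rho>)"
    "\<And>q. q \<notin> K \<Longrightarrow> \<rho> q = 0" "\<And>q. q \<in> N \<Longrightarrow> \<rho> q = (1::real)"
proof -
  let ?V = "coord c ` dom_chart c"
  have oV: "open ?V" using open_chart_image[OF c] .
  obtain r where r: "r > 0" "cball (coord c p) r \<subseteq> ?V"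
    using oV p open_contains_cball by blast
  obtain b :: "real^'n \<Rightarrow> real" where b: "smooth_on UNIV b" "\<And>x. x \<in> ball (coord c p) (r / 2) \<Longrightarrow> b x = 1"
    "\<And>x. x \<notin> ball (coord c p) r \<Longrightarrow> b x = 0"
    using bump_function[OF r(1)] by blast
  define K where "K = {q \<in> dom_chart c. coord c q \<in> cball (coord c p) r}"
  define N where "N = {q \<in> dom_chart c. coord c q \<in> ball (coord c p) (r / 2)}"
  define \<rho> where "\<rho> q = (if q \<in> dom_chart c then b (coord c q) else 0)" for q
  have top: "topspace (subtopology M (dom_chart c)) = dom_chart c"
    using dom_subset_topspace[OF c] by auto
  note hom = homeomorphic_coord[OF c]
  have "continuous_map (subtopology M (dom_chart c)) (top_of_set ?V) (coord c)"
    using homeomorphic_imp_continuous_map[OF hom] .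
  then have "openin (subtopology M (dom_chart c))
      {q \<in> topspace (subtopology M (dom_chart c)). coord c q \<in> ?V \<inter> ball (coord c p) (r / 2)}"
    by (rule openin_continuous_map_preimage) (simp add: openin_open_Int)
  also have "{q \<in> topspace (subtopology M (dom_chart c)). coord c q \<in> ?V \<inter> ball (coord c p) (r / 2)} = N"
    unfolding top by (auto simp: N_def)
  finally have oN: "openin M N"
    using openin_dom[OF c] by (simp add: openin_trans_full)
  have "compactin (top_of_set ?V) (coord c ` K)"
  proof -
    have "coord c ` K = cball (coord c p) r" using r(2) by (auto simp: K_def)
    then show ?thesis using r(2) by (simp add: compactin_subtopology)
  qed
  then have "compactin (subtopology M (dom_chart c)) K"
    using homeomorphic_map_compactness[OF hom, of K] top by (auto simp: K_def)
  then have "compactin M K" by (simp add: compactin_subtopology)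
  then have cK: "closedin M K"
    using smooth_manifold by (intro compactin_imp_closedin) (auto simp: smooth_manifold_def)
  have sm: "smooth_on ?V (in_chart c \<rho>)"
    by (rule smooth_on_cong[OF oV smooth_on_subset[OF b(1)]]) (auto simp: \<rho>_def in_chart_coord[OF c])
  show ?thesis
  proof (rule that[OF cK _ oN _ _ sm])
    show "\<rho> q = 0" if "q \<notin> K" for q
      using that b(3)[of "coord c q"] by (auto simp: \<rho>_def K_def)
    show "\<rho> q = 1" if "q \<in> N" for q
      using that b(2)[of "coord c q"] by (auto simp: \<rho>_def N_def)
  qed (use p r(1) in \<open>auto simp: K_def N_def\<close>)
qed

end

section \<open>Affine connections in local coordinates\<close>

locale cutoff = manifold M A for M :: "'a topology" and A :: "('a, 'n::finite) chart set" +
  fixes c :: "('a, 'n) chart" and \<rho> :: "'a \<Rightarrow> real" and K N :: "'a set"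
  assumes c: "c \<in> A"
    and closed_K: "closedin M K" and K_dom: "K \<subseteq> dom_chart c"
    and open_N: "openin M N" and N_dom: "N \<subseteq> dom_chart c"
    and smooth_\<rho>: "smooth_on (coord c ` dom_chart c) (in_chart c \<rho>)"
    and \<rho>_outside: "\<And>q. q \<notin> K \<Longrightarrow> \<rho> q = 0"
    and \<rho>_inside: "\<And>q. q \<in> N \<Longrightarrow> \<rho> q = 1"
begin

lemma \<rho>_outside_dom: "q \<notin> dom_chart c \<Longrightarrow> \<rho> q = 0"
  using \<rho>_outside K_dom by blast

text \<open>Only the values of \<open>f\<close> in the chart matter, since \<rho> is zero elsewhere;
  the product is a global function to which the axioms of a connection apply.\<close>

lemma smooth_function_cutoff:
  assumes "smooth_on (coord c ` dom_chart c) (in_chart c f)"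
  shows "smooth_function A (\<lambda>q. \<rho> q * f q)"
  unfolding smooth_function_def
proof
  fix d assume d: "d \<in> A"
  have "smooth_on (coord c ` dom_chart c) (in_chart c (\<lambda>q. \<rho> q * f q))"
    using smooth_on_scaleR[OF open_chart_image[OF c] smooth_\<rho> assms] by (simp add: in_chart_def comp_def)
  then have "smooth_on (coord c ` (dom_chart c \<inter> dom_chart d)) (in_chart c (\<lambda>q. \<rho> q * f q))"
    by (rule smooth_on_subset) auto
  then show "smooth_on (coord d ` dom_chart d) (in_chart d (\<lambda>q. \<rho> q * f q))"
    using \<rho>_outside by (intro smooth_extension[OF c d closed_K K_dom]) auto
qed

lemma smooth_function_\<rho>: "smooth_function A \<rho>"
proof -
  have "smooth_on (coord c ` dom_chart c) (in_chart c (\<lambda>q. 1 :: real))"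
    using smooth_on_const[OF open_chart_image[OF c], of 1] by (simp add: in_chart_def comp_def)
  from smooth_function_cutoff[OF this] show ?thesis by simp
qed

text \<open>The coordinate field of \<open>c\<close> in direction \<open>i\<close>, cut off by
  \<rho> so as to be global, and expressed in an arbitrary chart \<open>d\<close>. On
  \<open>N\<close> its components in \<open>c\<close> are constant.\<close>

definition frame :: "'n \<Rightarrow> ('a, 'n) field" where
  "frame i = (\<lambda>d q. if d \<in> A \<and> q \<in> dom_chart d \<and> q \<in> dom_chart c
     then \<rho> q *\<^sub>R chart_deriv c (coord d) q (axis i 1) else 0)"

lemma vector_field_frame: "vector_field A (frame i)"
proof (rule vector_fieldI)
  show "smooth_on (coord d ` dom_chart d) (in_chart d (frame i d))" if d: "d \<in> A" for d
  proof (rule smooth_extension[OF c d closed_K K_dom])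
    show "frame i d p = 0" if "p \<notin> K" for p
      using that by (simp add: frame_def \<rho>_outside)
    let ?S = "coord c ` (dom_chart c \<inter> dom_chart d)"
    have o: "open ?S"
      by (rule open_coord_image[OF c]) (auto intro: openin_Int openin_dom[OF c] openin_dom[OF d])
    have "smooth_on ?S (\<lambda>x. in_chart c \<rho> x *\<^sub>R frechet_derivative (in_chart c (coord d)) (at x) (axis i 1))"
      by (intro smooth_on_scaleR[OF o] smooth_on_subset[OF smooth_\<rho>] smooth_on_derivative
          smooth_transition[OF c d]) auto
    then show "smooth_on ?S (in_chart c (frame i d))"
      by (rule smooth_on_cong[OF o]) (auto simp: in_chart_coord[OF c] frame_def d chart_deriv_def)
  qed
  show "frame i d' p = chart_deriv d (coord d') p (frame i d p)"
    if "d \<in> A" "d' \<in> A" "p \<in> dom_chart d" "p \<in> dom_chart d'" for d d' p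
  proof (cases "p \<in> dom_chart c")
    case True
    have "in_chart d (coord d') differentiable (at (coord d p))"
      using smooth_on_has_derivative[OF smooth_transition[OF that(1,2)], of "coord d p"] that
      by (auto simp: differentiable_def)
    then have "chart_deriv c (coord d') p (axis i 1) =
        chart_deriv d (coord d') p (chart_deriv c (coord d) p (axis i 1))"
      using that True c by (intro chart_deriv_change_chart) auto
    then show ?thesis
      using that True linear_chart_deriv_coord[OF that] by (simp add: frame_def linear_cmul)
  next
    case False
    then show ?thesis
      using linear_chart_deriv_coord[OF that] by (simp add: frame_def linear_0)
  qed
qed (auto simp: frame_def)

lemma frame_chart: "q \<in> dom_chart c \<Longrightarrow> frame i c q = \<rho> q *\<^sub>R axis i 1"
  by (simp add: frame_def c chart_deriv_coord)

lemma smooth_component: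
  assumes "vector_field A X"
  shows "smooth_on (coord c ` dom_chart c) (in_chart c (\<lambda>q. X c q $ i))"
  using smooth_on_linear[OF bounded_linear_vec_nth open_chart_image[OF c] vector_field_smooth[OF assms c], of i]
  by (simp add: in_chart_def comp_def)

text \<open>The factor \<rho> makes this a global smooth function; it is the true component on
  \<open>N\<close>.\<close>

definition component :: "'n \<Rightarrow> ('a, 'n) field \<Rightarrow> 'a \<Rightarrow> real" where
  "component i X = (\<lambda>q. \<rho> q * X c q $ i)"

lemma smooth_function_component: "vector_field A X \<Longrightarrow> smooth_function A (component i X)"
  unfolding component_def by (intro smooth_function_cutoff smooth_component)

text \<open>One factor \<rho> comes from the coefficient and one from the frame field, hence the
  square on the left. The identity holds on all of \<open>M\<close>, so a connection may be applied
  to both sides.\<close>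

lemma frame_expansion:
  assumes X: "vector_field A X"
  shows "scale_field (\<lambda>q. \<rho> q * \<rho> q) X = (\<lambda>d q. \<Sum>i\<in>UNIV. scale_field (component i X) (frame i) d q)"
proof (rule vector_field_eqI)
  show "vector_field A (scale_field (\<lambda>q. \<rho> q * \<rho> q) X)"
    by (intro vector_field_scale smooth_function_mult smooth_function_\<rho> X)
  show "vector_field A (\<lambda>d q. \<Sum>i\<in>UNIV. scale_field (component i X) (frame i) d q)"
    by (intro vector_field_sum vector_field_scale smooth_function_component vector_field_frame X)
  show "scale_field (\<lambda>q. \<rho> q * \<rho> q) X d q = (\<Sum>i\<in>UNIV. scale_field (component i X) (frame i) d q)"
    if d: "d \<in> A" "q \<in> dom_chart d" for d q
  proof (cases "q \<in> dom_chart c")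
    case True
    have "X d q = chart_deriv c (coord d) q (X c q)"
      using vector_field_transform[OF X c d(1) True d(2)] .
    also have "\<dots> = (\<Sum>i\<in>UNIV. (X c q $ i) *\<^sub>R chart_deriv c (coord d) q (axis i 1))"
      by (rule linear_axis_expansion[OF linear_chart_deriv_coord[OF c d(1) True d(2)]])
    finally show ?thesis
      using d True by (simp add: scale_field_def component_def frame_def scaleR_sum_right ac_simps)
  next
    case False
    then show ?thesis by (simp add: scale_field_def frame_def \<rho>_outside_dom)
  qed
qed

section \<open>Locality of a connection and its Christoffel symbols\<close>

context
  fixes D :: "('a, 'n) connection"
  assumes D: "affine_connection A D"
begin

lemma connection_vector_field: "vector_field A X \<Longrightarrow> vector_field A Y \<Longrightarrow> vector_field A (D X Y)"
  using D unfolding affine_connection_def by blast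

lemma connection_add_left:
  "vector_field A X \<Longrightarrow> vector_field A X' \<Longrightarrow> vector_field A Y \<Longrightarrow>
    D (add_field X X') Y = add_field (D X Y) (D X' Y)"
  using D unfolding affine_connection_def by blast

lemma connection_add_right:
  "vector_field A X \<Longrightarrow> vector_field A Y \<Longrightarrow> vector_field A Y' \<Longrightarrow>
    D X (add_field Y Y') = add_field (D X Y) (D X Y')"
  using D unfolding affine_connection_def by blast

lemma connection_scale_left:
  "smooth_function A f \<Longrightarrow> vector_field A X \<Longrightarrow> vector_field A Y \<Longrightarrow>
    D (scale_field f X) Y = scale_field f (D X Y)"
  using D unfolding affine_connection_def by blast

lemma connection_scale_right:
  "smooth_function A f \<Longrightarrow> vector_field A X \<Longrightarrow> vector_field A Y \<Longrightarrow> q \<in> dom_chart c \<Longrightarrow>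
    D X (scale_field f Y) c q = f q *\<^sub>R D X Y c q + chart_deriv c f q (X c q) *\<^sub>R Y c q"
  using D c unfolding affine_connection_def by blast

lemma connection_zero:
  assumes "vector_field A X"
  shows "D X (\<lambda>d q. 0) = (\<lambda>d q. 0)" "D (\<lambda>d q. 0) X = (\<lambda>d q. 0)"
  using connection_add_right[OF assms vector_field_zero vector_field_zero]
    connection_add_left[OF vector_field_zero vector_field_zero assms]
  by (simp_all add: add_field_def fun_eq_iff)

lemma connection_sum:
  assumes "vector_field A X" "\<And>i. i \<in> I \<Longrightarrow> vector_field A (F i)"
  shows "D (\<lambda>d q. \<Sum>i\<in>I. F i d q) X = (\<lambda>d q. \<Sum>i\<in>I. D (F i) X d q)"
    and "D X (\<lambda>d q. \<Sum>i\<in>I. F i d q) = (\<lambda>d q. \<Sum>i\<in>I. D X (F i) d q)"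
  using assms(2)
proof (induction I rule: infinite_finite_induct)
  case (insert i I)
  {
    case 1
    then show ?case
      using insert connection_add_left[of "F i" "\<lambda>d q. \<Sum>i\<in>I. F i d q" X] assms(1) vector_field_sum[of I F]
      by (simp add: add_field_def)
  next
    case 2
    then show ?case
      using insert connection_add_right[of X "F i" "\<lambda>d q. \<Sum>i\<in>I. F i d q"] assms(1) vector_field_sum[of I F]
      by (simp add: add_field_def)
  }
qed (simp_all add: connection_zero assms(1))

text \<open>The upper index is the component of the vector. These are the classical symbols of
  \<open>D\<close> on \<open>N\<close>; elsewhere the cutoff interferes.\<close>

definition christoffel :: "'n \<Rightarrow> 'n \<Rightarrow> 'a \<Rightarrow> real^'n" where
  "christoffel i j = D (frame i) (frame j) c"

text \<open>At \<open>q\<close> both fields may be multiplied by the square of \<rho>: in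
  \<open>X\<close> the connection is linear over functions, and in \<open>Y\<close> the extra term
  contains the derivative of a function that is constant on the open set \<open>N\<close>. The
  multiplied fields are expanded in the frame.\<close>

lemma connection_local:
  assumes X: "vector_field A X" and Y: "vector_field A Y" and q: "q \<in> N"
  shows "D X Y c q = (\<Sum>i\<in>UNIV. X c q $ i *\<^sub>R (chart_deriv c (Y c) q (axis i 1) +
    (\<Sum>j\<in>UNIV. Y c q $ j *\<^sub>R christoffel i j q)))"
proof -
  let ?g = "\<lambda>q. \<rho> q * \<rho> q"
  have g: "smooth_function A ?g"
    by (intro smooth_function_mult smooth_function_\<rho>)
  have qc: "q \<in> dom_chart c" using q N_dom by blast
  have "D X Y c q = D (scale_field ?g X) Y c q"
    using q by (simp add: connection_scale_left[OF g X Y]) (simp add: scale_field_def \<rho>_inside)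
  also have "\<dots> = (\<Sum>i\<in>UNIV. D (scale_field (component i X) (frame i)) Y c q)"
    unfolding frame_expansion[OF X]
    by (simp add: connection_sum Y vector_field_scale smooth_function_component vector_field_frame X)
  also have "\<dots> = (\<Sum>i\<in>UNIV. X c q $ i *\<^sub>R D (frame i) Y c q)"
    by (simp add: connection_scale_left smooth_function_component vector_field_frame X Y)
      (simp add: scale_field_def component_def \<rho>_inside q)
  finally have 1: "D X Y c q = (\<Sum>i\<in>UNIV. X c q $ i *\<^sub>R D (frame i) Y c q)" .
  have 2: "D (frame i) Y c q = chart_deriv c (Y c) q (axis i 1) + (\<Sum>j\<in>UNIV. Y c q $ j *\<^sub>R christoffel i j q)"
    for i
  proof -
    have "chart_deriv c ?g q = (\<lambda>v. 0)"
      using chart_deriv_const_near[OF c open_N N_dom q, of ?g 1] by (simp add: \<rho>_inside)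
    then have "D (frame i) Y c q = D (frame i) (scale_field ?g Y) c q"
      using q by (simp add: connection_scale_right[OF g vector_field_frame Y qc] \<rho>_inside)
    also have "\<dots> = (\<Sum>j\<in>UNIV. D (frame i) (scale_field (component j Y) (frame j)) c q)"
      unfolding frame_expansion[OF Y]
      by (simp add: connection_sum Y vector_field_scale smooth_function_component vector_field_frame)
    also have "\<dots> = (\<Sum>j\<in>UNIV. Y c q $ j *\<^sub>R christoffel i j q +
        (chart_deriv c (Y c) q (axis i 1) $ j) *\<^sub>R axis j 1)"
    proof (rule sum.cong[OF refl])
      fix j
      have "(in_chart c (Y c) has_derivative frechet_derivative (in_chart c (Y c)) (at (coord c q))) (at (coord c q))"
        by (rule smooth_on_has_derivative[OF vector_field_smooth[OF Y c]]) (use qc in auto)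
      from bounded_linear.has_derivative[OF bounded_linear_vec_nth this, of j]
      have d: "(in_chart c (\<lambda>q. Y c q $ j) has_derivative
          (\<lambda>v. frechet_derivative (in_chart c (Y c)) (at (coord c q)) v $ j)) (at (coord c q))"
        by (simp add: in_chart_def comp_def)
      have "chart_deriv c (component j Y) q = chart_deriv c (\<lambda>q. Y c q $ j) q"
        using d by (intro chart_deriv_cong[symmetric, OF c open_N N_dom q])
          (auto simp: component_def \<rho>_inside differentiable_def)
      also have "\<dots> = (\<lambda>v. chart_deriv c (Y c) q v $ j)"
        using frechet_derivative_at[OF d, symmetric] by (simp add: chart_deriv_def[abs_def])
      finally show "D (frame i) (scale_field (component j Y) (frame j)) c q =
          Y c q $ j *\<^sub>R christoffel i j q + (chart_deriv c (Y c) q (axis i 1) $ j) *\<^sub>R axis j 1"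
        using connection_scale_right[OF smooth_function_component vector_field_frame vector_field_frame qc, OF Y]
        by (simp add: frame_chart[OF qc] \<rho>_inside[OF q] christoffel_def component_def)
    qed
    also have "\<dots> = (\<Sum>j\<in>UNIV. Y c q $ j *\<^sub>R christoffel i j q) + chart_deriv c (Y c) q (axis i 1)"
      by (simp add: sum.distrib linear_axis_expansion[OF linear_id, of "chart_deriv c (Y c) q (axis i 1)", simplified, symmetric])
    finally show ?thesis by simp
  qed
  show ?thesis unfolding 1 2 ..
qed

lemma smooth_christoffel: "smooth_on (coord c ` dom_chart c) (in_chart c (christoffel i j))"
  unfolding christoffel_def
  by (rule vector_field_smooth[OF connection_vector_field[OF vector_field_frame vector_field_frame] c])

text \<open>The frame fields have constant components on \<open>N\<close>, so their Lie bracket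
  vanishes there and torsion-freeness becomes symmetry of the symbols.\<close>

lemma christoffel_symmetric:
  assumes "torsion_free A D" "q \<in> N"
  shows "christoffel i j q = christoffel j i q"
proof -
  have qc: "q \<in> dom_chart c" using assms N_dom by blast
  have "chart_deriv c (frame k c) q = (\<lambda>v. 0)" for k
    by (rule chart_deriv_const_near[OF c open_N N_dom assms(2), of _ "axis k 1"])
      (use N_dom in \<open>auto simp: frame_chart \<rho>_inside\<close>)
  then have "lie_bracket (frame i) (frame j) c q = 0"
    by (simp add: lie_bracket_def)
  moreover have "D (frame i) (frame j) c q - D (frame j) (frame i) c q = lie_bracket (frame i) (frame j) c q"
    using assms(1) c qc vector_field_frame unfolding torsion_free_def by blast
  ultimately show ?thesis
    by (simp add: christoffel_def)
qed

end

end

section \<open>The curvature in local coordinates\<close>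

context manifold
begin

section \<open>Rules of differentiation in a chart\<close>

definition chart_differentiable :: "('a, 'n) chart \<Rightarrow> ('a \<Rightarrow> 'b::real_normed_vector) \<Rightarrow> 'a \<Rightarrow> bool" where
  "chart_differentiable c f p \<longleftrightarrow> in_chart c f differentiable (at (coord c p))"

lemma chart_derivI:
  assumes "(in_chart c f has_derivative f') (at (coord c p))"
  shows "chart_differentiable c f p" "chart_deriv c f p = f'"
  using assms frechet_derivative_at[OF assms]
  by (auto simp: chart_differentiable_def chart_deriv_def[abs_def] differentiable_def)

lemma chart_derivD:
  "chart_differentiable c f p \<Longrightarrow> (in_chart c f has_derivative chart_deriv c f p) (at (coord c p))"
  by (simp add: chart_differentiable_def chart_deriv_def[abs_def] frechet_derivative_works)

lemma chart_differentiable_smooth: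
  "smooth_on (coord c ` dom_chart c) (in_chart c f) \<Longrightarrow> p \<in> dom_chart c \<Longrightarrow> chart_differentiable c f p"
  using smooth_on_has_derivative by (fastforce simp: chart_differentiable_def differentiable_def)

lemma chart_deriv_add:
  assumes "chart_differentiable c f p" "chart_differentiable c g p"
  shows "chart_differentiable c (\<lambda>q. f q + g q) p"
    "chart_deriv c (\<lambda>q. f q + g q) p = (\<lambda>v. chart_deriv c f p v + chart_deriv c g p v)"
  using has_derivative_add[OF chart_derivD[OF assms(1)] chart_derivD[OF assms(2)]]
  by (intro chart_derivI; simp add: in_chart_def comp_def)+

lemma chart_deriv_const:
  "chart_differentiable c (\<lambda>q. k) p" "chart_deriv c (\<lambda>q. k) p = (\<lambda>v. 0)"
proof -
  have *: "(in_chart c (\<lambda>q. k) has_derivative (\<lambda>v. 0)) (at (coord c p))"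
    by (simp add: in_chart_def comp_def)
  show "chart_differentiable c (\<lambda>q. k) p" "chart_deriv c (\<lambda>q. k) p = (\<lambda>v. 0)"
    by (rule chart_derivI[OF *])+
qed

lemma chart_deriv_scaleR:
  fixes f :: "'a \<Rightarrow> real"
  assumes "c \<in> A" "p \<in> dom_chart c" "chart_differentiable c f p" "chart_differentiable c g p"
  shows "chart_differentiable c (\<lambda>q. f q *\<^sub>R g q) p"
    "chart_deriv c (\<lambda>q. f q *\<^sub>R g q) p = (\<lambda>v. f p *\<^sub>R chart_deriv c g p v + chart_deriv c f p v *\<^sub>R g p)"
proof -
  have "(in_chart c (\<lambda>q. f q *\<^sub>R g q) has_derivative
      (\<lambda>v. f p *\<^sub>R chart_deriv c g p v + chart_deriv c f p v *\<^sub>R g p)) (at (coord c p))"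
    using has_derivative_scaleR[OF chart_derivD[OF assms(3)] chart_derivD[OF assms(4)]] assms(1,2)
    by (simp add: in_chart_def comp_def inv_into_f_f inj_coord)
  from chart_derivI[OF this] show "chart_differentiable c (\<lambda>q. f q *\<^sub>R g q) p"
    "chart_deriv c (\<lambda>q. f q *\<^sub>R g q) p = (\<lambda>v. f p *\<^sub>R chart_deriv c g p v + chart_deriv c f p v *\<^sub>R g p)"
    by auto
qed

lemma chart_deriv_sum:
  assumes "\<And>i. i \<in> I \<Longrightarrow> chart_differentiable c (f i) p"
  shows "chart_differentiable c (\<lambda>q. \<Sum>i\<in>I. f i q) p"
    "chart_deriv c (\<lambda>q. \<Sum>i\<in>I. f i q) p = (\<lambda>v. \<Sum>i\<in>I. chart_deriv c (f i) p v)"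
  using assms
  by (induction I rule: infinite_finite_induct) (simp_all add: chart_deriv_const chart_deriv_add)

lemma chart_deriv_nth:
  assumes "chart_differentiable c f p"
  shows "chart_differentiable c (\<lambda>q. f q $ i) p"
    "chart_deriv c (\<lambda>q. f q $ i) p = (\<lambda>v. chart_deriv c f p v $ i)"
  using bounded_linear.has_derivative[OF bounded_linear_vec_nth chart_derivD[OF assms], of i]
  by (intro chart_derivI; simp add: in_chart_def comp_def)+

lemma smooth_chart_deriv:
  assumes "c \<in> A" "smooth_on (coord c ` dom_chart c) (in_chart c f)"
  shows "smooth_on (coord c ` dom_chart c) (in_chart c (\<lambda>q. chart_deriv c f q v))"
  by (rule smooth_on_cong[OF open_chart_image[OF assms(1)] smooth_on_derivative[OF assms(2), of v]])
    (use assms(1) in \<open>auto simp: in_chart_coord chart_deriv_def\<close>)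

lemma chart_deriv_symmetric_real:
  fixes f :: "'a \<Rightarrow> real"
  assumes c: "c \<in> A" "p \<in> dom_chart c" and f: "smooth_on (coord c ` dom_chart c) (in_chart c f)"
  shows "chart_deriv c (\<lambda>q. chart_deriv c f q u) p v = chart_deriv c (\<lambda>q. chart_deriv c f q v) p u"
proof -
  let ?V = "coord c ` dom_chart c"
  have "chart_deriv c (\<lambda>q. chart_deriv c f q w) p =
      frechet_derivative (\<lambda>x. frechet_derivative (in_chart c f) (at x) w) (at (coord c p))" for w
  proof -
    have "(\<lambda>x. frechet_derivative (in_chart c f) (at x) w) differentiable (at (coord c p))"
      using smooth_on_has_derivative[OF smooth_on_derivative[OF f]] c by (auto simp: differentiable_def)
    then show ?thesis
      using c unfolding chart_deriv_def
      by (intro frechet_derivative_transform_within_open[OF _ open_chart_image[OF c(1)], symmetric])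
        (auto simp: in_chart_coord)
  qed
  then show ?thesis
    using second_derivative_symmetric[OF open_chart_image[OF c(1)] _ smooth_onD[OF f], of "coord c p"] c
    by simp
qed

text \<open>Taken component by component, since the mean value argument behind the symmetry works
  for real-valued functions.\<close>

lemma chart_deriv_symmetric:
  fixes f :: "'a \<Rightarrow> real^'m::finite"
  assumes c: "c \<in> A" "p \<in> dom_chart c" and f: "smooth_on (coord c ` dom_chart c) (in_chart c f)"
  shows "chart_deriv c (\<lambda>q. chart_deriv c f q u) p v = chart_deriv c (\<lambda>q. chart_deriv c f q v) p u"
proof -
  have fi: "smooth_on (coord c ` dom_chart c) (in_chart c (\<lambda>q. f q $ i))" for i
    using smooth_on_linear[OF bounded_linear_vec_nth open_chart_image[OF c(1)] f, of i]
    by (simp add: in_chart_def comp_def)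
  have "chart_deriv c (\<lambda>q. chart_deriv c f q u) p v $ i = chart_deriv c (\<lambda>q. chart_deriv c (\<lambda>q. f q $ i) q u) p v"
    for i u v
  proof -
    have "chart_differentiable c (\<lambda>q. chart_deriv c f q u) p"
      by (rule chart_differentiable_smooth[OF smooth_chart_deriv[OF c(1) f] c(2)])
    note * = chart_deriv_nth[OF this, of i]
    have "chart_deriv c (\<lambda>q. chart_deriv c f q u) p v $ i = chart_deriv c (\<lambda>q. chart_deriv c f q u $ i) p v"
      by (simp add: *)
    also have "chart_deriv c (\<lambda>q. chart_deriv c f q u $ i) p = chart_deriv c (\<lambda>q. chart_deriv c (\<lambda>q. f q $ i) q u) p"
      using *(1) by (intro chart_deriv_cong[OF c(1) openin_dom[OF c(1)] _ c(2)])
        (auto simp: chart_differentiable_def[symmetric] chart_deriv_nth chart_differentiable_smooth[OF f])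
    finally show ?thesis .
  qed
  then show ?thesis
    using chart_deriv_symmetric_real[OF c fi] by (simp add: vec_eq_iff)
qed

end

text \<open>The classical formula for the curvature, with \<open>G a b i\<close> for \<Gamma>_ab^i
  and \<open>dG a b d i\<close> for the partial derivative in direction \<open>a\<close> of
  \<Gamma>_bd^i. The two arrays are independent arguments, so that identities between curvatures
  become finite algebra.\<close>

definition christoffel_curvature :: "('n \<Rightarrow> 'n \<Rightarrow> 'n \<Rightarrow> 'n \<Rightarrow> real) \<Rightarrow> ('n::finite \<Rightarrow> 'n \<Rightarrow> 'n \<Rightarrow> real) \<Rightarrow> 'n tensor4" where
  "christoffel_curvature dG G a b i d =
     dG a b d i - dG b a d i + (\<Sum>e\<in>UNIV. G a e i * G b d e - G b e i * G a d e)"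

lemma christoffel_curvature_skew: "christoffel_curvature dG G a b i d = - christoffel_curvature dG G b a i d"
  by (simp add: christoffel_curvature_def sum_subtractf)

text \<open>In the cyclic sum each term meets a term of opposite sign that differs from it only by
  the order of the two lower indices of a symbol.\<close>

lemma christoffel_curvature_bianchi:
  assumes "\<And>a b i. G a b i = G b a i" "\<And>a b d i. dG a b d i = dG a d b i"
  shows "christoffel_curvature dG G a b i d + christoffel_curvature dG G b d i a +
    christoffel_curvature dG G d a i b = 0"
  using assms(1)[of b d] assms(1)[of d a] assms(1)[of a b] assms(2)[of a b d] assms(2)[of b d a] assms(2)[of d a b]
  by (simp add: christoffel_curvature_def sum_subtractf)

text \<open>With \<open>du a b\<close> read as the partial derivative in direction \<open>a\<close>
  of \<open>u b\<close>, the tensor \<open>S\<close> is u_b u_d minus the covariant derivative of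
  \<open>u\<close>, which is the change of the Schouten tensor. The last term is the exterior
  derivative of \<open>u\<close>.\<close>

lemma christoffel_curvature_projective_change:
  fixes G :: "'n::finite \<Rightarrow> 'n \<Rightarrow> 'n \<Rightarrow> real" and u :: "'n \<Rightarrow> real" and du :: "'n \<Rightarrow> 'n \<Rightarrow> real"
    and dG :: "'n \<Rightarrow> 'n \<Rightarrow> 'n \<Rightarrow> 'n \<Rightarrow> real"
  assumes sym: "\<And>a b i. G a b i = G b a i"
  defines "G' \<equiv> \<lambda>a b i. G a b i + u a * delta i b + u b * delta i a"
    and "dG' \<equiv> \<lambda>a b d i. dG a b d i + du a b * delta i d + du a d * delta i b"
    and "S \<equiv> \<lambda>b d. - du b d + (\<Sum>e\<in>UNIV. u e * G b d e) + u b * u d"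
  shows "christoffel_curvature dG' G' a b i d = christoffel_curvature dG G a b i d +
    (delta i a * S b d - delta i b * S a d) + (du a b - du b a) * delta i d"
proof -
  have *: "(\<Sum>e\<in>UNIV. G' a e i * G' b d e) = (\<Sum>e\<in>UNIV. G a e i * G b d e) + u b * G a d i + u d * G a b i +
      u a * G b d i + delta i a * (\<Sum>e\<in>UNIV. u e * G b d e) +
      u a * (u b * delta i d + u d * delta i b) + delta i a * (2 * (u b * u d))" for a b
  proof -
    have "G' a e i * G' b d e = G a e i * G b d e + u b * (G a e i * delta e d) + u d * (G a e i * delta e b)
      + u a * (delta i e * G b d e) + u a * u b * (delta i e * delta e d) + u a * u d * (delta i e * delta e b)
      + delta i a * (u e * G b d e) + delta i a * u b * (u e * delta e d) + delta i a * u d * (u e * delta e b)" for e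
      by (simp add: G'_def algebra_simps)
    then show ?thesis
      by (simp add: sum.distrib sum_distrib_left[symmetric] delta_sums) (simp add: algebra_simps)
  qed
  \<comment> \<open>Skewing over \<open>a\<close> and \<open>b\<close> removes all products
    symmetric in them. The term with coefficient 2 and the one with
    \<open>u a * u d * delta i b\<close> combine, leaving coefficient 1 for \<open>u b * u d\<close>
    in \<open>S\<close>.\<close>
  show ?thesis
    unfolding christoffel_curvature_def sum_subtractf * using sym[of a b i]
    by (simp add: dG'_def S_def algebra_simps)
qed

section \<open>Second covariant derivatives and curvature near a point\<close>

context cutoff
begin

context
  fixes D :: "('a, 'n) connection" and p :: 'a
  assumes D: "affine_connection A D" and p: "p \<in> N"
begin

lemma p_dom: "p \<in> dom_chart c"
  using p N_dom by blast

abbreviation partial :: "'n \<Rightarrow> ('a \<Rightarrow> 'b::real_normed_vector) \<Rightarrow> 'a \<Rightarrow> 'b" where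
  "partial a f q \<equiv> chart_deriv c f q (axis a 1)"

text \<open>The covariant derivative of \<open>Z\<close> along a coordinate field, written out in
  the symbols so that it can be differentiated once more.\<close>

definition frame_deriv :: "('a, 'n) field \<Rightarrow> 'n \<Rightarrow> 'a \<Rightarrow> real^'n" where
  "frame_deriv Z b q = partial b (Z c) q + (\<Sum>j\<in>UNIV. Z c q $ j *\<^sub>R christoffel D b j q)"

lemma connection_frame_deriv:
  "vector_field A X \<Longrightarrow> vector_field A Z \<Longrightarrow> q \<in> N \<Longrightarrow>
    D X Z c q = (\<Sum>b\<in>UNIV. X c q $ b *\<^sub>R frame_deriv Z b q)"
  by (simp add: connection_local[OF D] frame_deriv_def)

lemma differentiable_vector_field: "vector_field A Z \<Longrightarrow> chart_differentiable c (Z c) p"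
  by (rule chart_differentiable_smooth[OF vector_field_smooth[OF _ c] p_dom])

lemma differentiable_christoffel: "chart_differentiable c (christoffel D i j) p"
  by (rule chart_differentiable_smooth[OF smooth_christoffel[OF D] p_dom])

lemma differentiable_partial: "vector_field A Z \<Longrightarrow> chart_differentiable c (partial b (Z c)) p"
  by (rule chart_differentiable_smooth[OF smooth_chart_deriv[OF c vector_field_smooth[OF _ c]] p_dom])

lemma frame_deriv_deriv:
  assumes Z: "vector_field A Z"
  shows "chart_differentiable c (frame_deriv Z b) p"
    "partial a (frame_deriv Z b) p = partial a (partial b (Z c)) p +
      (\<Sum>d\<in>UNIV. Z c p $ d *\<^sub>R partial a (christoffel D b d) p + partial a (Z c) p $ d *\<^sub>R christoffel D b d p)"
  unfolding frame_deriv_def[abs_def]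
  by (simp_all add: chart_deriv_add chart_deriv_sum chart_deriv_scaleR chart_deriv_nth c p_dom
      differentiable_vector_field[OF Z] differentiable_partial[OF Z] differentiable_christoffel)

text \<open>The subtracted term of \<open>second_deriv\<close> cancels every derivative of
  \<open>Y\<close>, so the result is tensorial in \<open>X\<close> and \<open>Y\<close>. What it
  leaves behind is the sum with \<open>christoffel D a b p $ e\<close>, symmetric in
  \<open>a\<close> and \<open>b\<close> for a torsion-free connection.\<close>

lemma second_deriv_local:
  assumes X: "vector_field A X" and Y: "vector_field A Y" and Z: "vector_field A Z"
  shows "second_deriv D X Y Z c p = (\<Sum>a\<in>UNIV. \<Sum>b\<in>UNIV. (X c p $ a * Y c p $ b) *\<^sub>R
    (partial a (frame_deriv Z b) p + (\<Sum>j\<in>UNIV. frame_deriv Z b p $ j *\<^sub>R christoffel D a j p)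
      - (\<Sum>e\<in>UNIV. christoffel D a b p $ e *\<^sub>R frame_deriv Z e p)))"
proof -
  note DYZ = connection_vector_field[OF D Y Z]
  have dif: "chart_differentiable c (\<lambda>q. \<Sum>b\<in>UNIV. Y c q $ b *\<^sub>R frame_deriv Z b q) p"
    by (intro chart_deriv_sum chart_deriv_scaleR chart_deriv_nth c p_dom frame_deriv_deriv Z
        differentiable_vector_field Y)
  have "chart_deriv c (D Y Z c) p = chart_deriv c (\<lambda>q. \<Sum>b\<in>UNIV. Y c q $ b *\<^sub>R frame_deriv Z b q) p"
    using differentiable_vector_field[OF DYZ] unfolding chart_differentiable_def
    by (intro chart_deriv_cong[OF c open_N N_dom p]) (simp_all add: connection_frame_deriv Y Z)
  then have partial_DYZ: "partial a (D Y Z c) p = (\<Sum>b\<in>UNIV. Y c p $ b *\<^sub>R partial a (frame_deriv Z b) p +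
      partial a (Y c) p $ b *\<^sub>R frame_deriv Z b p)" for a
    by (simp add: chart_deriv_sum chart_deriv_scaleR chart_deriv_nth c p_dom frame_deriv_deriv(1) Z
        differentiable_vector_field Y)
  have 1: "D X (D Y Z) c p = (\<Sum>a\<in>UNIV. X c p $ a *\<^sub>R ((\<Sum>b\<in>UNIV. Y c p $ b *\<^sub>R partial a (frame_deriv Z b) p) +
      (\<Sum>b\<in>UNIV. partial a (Y c) p $ b *\<^sub>R frame_deriv Z b p) +
      (\<Sum>j\<in>UNIV. \<Sum>b\<in>UNIV. (Y c p $ b * frame_deriv Z b p $ j) *\<^sub>R christoffel D a j p)))"
    using connection_frame_deriv[OF X DYZ p]
    by (simp add: frame_deriv_def[of "D Y Z"] partial_DYZ connection_frame_deriv[OF Y Z p]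
        sum.distrib scaleR_sum_left)
  have 2: "D (D X Y) Z c p = (\<Sum>b\<in>UNIV. \<Sum>a\<in>UNIV. X c p $ a *\<^sub>R
      (partial a (Y c) p $ b *\<^sub>R frame_deriv Z b p + (\<Sum>j\<in>UNIV. (Y c p $ j * christoffel D a j p $ b) *\<^sub>R frame_deriv Z b p)))"
    using connection_frame_deriv[OF connection_vector_field[OF D X Y] Z p]
    by (simp add: connection_frame_deriv[OF X Y p] frame_deriv_def[of Y] scaleR_sum_left scaleR_add_left
        scaleR_add_right distrib_left sum_distrib_left scaleR_sum_right mult.assoc)
  have 3: "(\<Sum>j\<in>UNIV. \<Sum>b\<in>UNIV. (Y c p $ b * frame_deriv Z b p $ j) *\<^sub>R christoffel D a j p) =
      (\<Sum>b\<in>UNIV. Y c p $ b *\<^sub>R (\<Sum>j\<in>UNIV. frame_deriv Z b p $ j *\<^sub>R christoffel D a j p))" for a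
    by (subst sum.swap) (simp add: scaleR_sum_right)
  have 4: "(\<Sum>b\<in>UNIV. \<Sum>j\<in>UNIV. (Y c p $ j * christoffel D a j p $ b) *\<^sub>R frame_deriv Z b p) =
      (\<Sum>b\<in>UNIV. Y c p $ b *\<^sub>R (\<Sum>e\<in>UNIV. christoffel D a b p $ e *\<^sub>R frame_deriv Z e p))" for a
    by (subst sum.swap) (simp add: scaleR_sum_right)
  have 2: "D (D X Y) Z c p = (\<Sum>a\<in>UNIV. X c p $ a *\<^sub>R ((\<Sum>b\<in>UNIV. partial a (Y c) p $ b *\<^sub>R frame_deriv Z b p) +
      (\<Sum>b\<in>UNIV. Y c p $ b *\<^sub>R (\<Sum>e\<in>UNIV. christoffel D a b p $ e *\<^sub>R frame_deriv Z e p))))"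
    unfolding 2 by (subst sum.swap) (simp add: 4[symmetric] sum.distrib[symmetric] scaleR_sum_right[symmetric])
  \<comment> \<open>\<open>E\<close> stands for the terms with derivatives of \<open>Y\<close>,
    common to both sums; \<open>P\<close>, \<open>Q\<close> and \<open>T\<close> are the three parts
    of the claimed summand.\<close>
  have combine: "(\<Sum>a\<in>UNIV. x a *\<^sub>R ((\<Sum>b\<in>UNIV. y b *\<^sub>R P a b) + E a + (\<Sum>b\<in>UNIV. y b *\<^sub>R Q a b))) -
      (\<Sum>a\<in>UNIV. x a *\<^sub>R (E a + (\<Sum>b\<in>UNIV. y b *\<^sub>R T a b))) =
      (\<Sum>a\<in>UNIV. \<Sum>b\<in>UNIV. (x a * y b) *\<^sub>R (P a b + Q a b - T a b))"
    for x y :: "'n \<Rightarrow> real" and P Q T :: "'n \<Rightarrow> 'n \<Rightarrow> real^'n" and E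
    by (simp add: sum.distrib sum_subtractf scaleR_sum_right scaleR_add_right scaleR_diff_right)
  show ?thesis
    unfolding second_deriv_def 1 2 3
    by (rule combine)
qed

definition local_curvature :: "'n tensor4" where
  "local_curvature = christoffel_curvature (\<lambda>a b d i. partial a (christoffel D b d) p $ i)
     (\<lambda>a b i. christoffel D a b p $ i)"

context
  assumes torsion_free: "torsion_free A D"
begin

text \<open>Under skewing over \<open>a\<close> and \<open>b\<close> the second partial derivatives
  of \<open>Z\<close> cancel by Schwarz's theorem, the terms pairing a first derivative of
  \<open>Z\<close> with a symbol cancel against each other, and the term from \<open>D X Y\<close>
  cancels by torsion-freeness. Only terms algebraic in \<open>Z\<close> survive.\<close>

lemma curvature_identity:
  assumes X: "vector_field A X" and Y: "vector_field A Y" and Z: "vector_field A Z"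
  shows "(second_deriv D X Y Z c p - second_deriv D Y X Z c p) $ i =
    (\<Sum>a\<in>UNIV. \<Sum>b\<in>UNIV. \<Sum>d\<in>UNIV. local_curvature a b i d * X c p $ a * Y c p $ b * Z c p $ d)"
proof -
  let ?H = "\<lambda>a b. partial a (frame_deriv Z b) p + (\<Sum>j\<in>UNIV. frame_deriv Z b p $ j *\<^sub>R christoffel D a j p)
      - (\<Sum>e\<in>UNIV. christoffel D a b p $ e *\<^sub>R frame_deriv Z e p)"
  note sym = christoffel_symmetric[OF D torsion_free p]
  have "second_deriv D Y X Z c p = (\<Sum>a\<in>UNIV. \<Sum>b\<in>UNIV. (X c p $ a * Y c p $ b) *\<^sub>R ?H b a)"
    by (subst second_deriv_local[OF Y X Z], subst sum.swap) (simp add: mult.commute)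
  then have "second_deriv D X Y Z c p - second_deriv D Y X Z c p =
      (\<Sum>a\<in>UNIV. \<Sum>b\<in>UNIV. (X c p $ a * Y c p $ b) *\<^sub>R (?H a b - ?H b a))"
    by (simp only: second_deriv_local[OF X Y Z] sum_subtractf[symmetric] scaleR_diff_right[symmetric])
  moreover have "(?H a b - ?H b a) $ i = (\<Sum>d\<in>UNIV. local_curvature a b i d * Z c p $ d)" for a b
  proof -
    have "partial a (partial b (Z c)) p = partial b (partial a (Z c)) p"
      by (rule chart_deriv_symmetric[OF c p_dom vector_field_smooth[OF Z c]])
    moreover have "(\<Sum>j\<in>UNIV. (\<Sum>d\<in>UNIV. Z c p $ d * christoffel D b d p $ j) * christoffel D a j p $ i) =
        (\<Sum>d\<in>UNIV. (\<Sum>e\<in>UNIV. christoffel D a e p $ i * christoffel D b d p $ e) * Z c p $ d)" for a b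
      unfolding sum_distrib_right by (subst sum.swap) (simp add: ac_simps)
    ultimately show ?thesis
      using sym[of a b]
      by (simp add: frame_deriv_deriv Z frame_deriv_def local_curvature_def christoffel_curvature_def
          sum.distrib sum_subtractf algebra_simps)
  qed
  ultimately show ?thesis
    by (simp add: sum_distrib_left ac_simps)
qed

text \<open>At \<open>p\<close> the frame fields are the standard basis vectors, so evaluating on
  them reads off each component; this is the uniqueness that the definite description needs.\<close>

lemma curvature_eq_local_curvature: "curvature A D c p = local_curvature"
  unfolding curvature_def
proof (rule the_equality)
  show "\<forall>X Y Z. vector_field A X \<and> vector_field A Y \<and> vector_field A Z \<longrightarrow>
     (\<forall>i. (second_deriv D X Y Z c p - second_deriv D Y X Z c p) $ i =
        (\<Sum>a\<in>UNIV. \<Sum>b\<in>UNIV. \<Sum>d\<in>UNIV. local_curvature a b i d * X c p $ a * Y c p $ b * Z c p $ d))"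
    using curvature_identity by blast
next
  fix R :: "'n tensor4"
  assume R: "\<forall>X Y Z. vector_field A X \<and> vector_field A Y \<and> vector_field A Z \<longrightarrow>
     (\<forall>i. (second_deriv D X Y Z c p - second_deriv D Y X Z c p) $ i =
        (\<Sum>a\<in>UNIV. \<Sum>b\<in>UNIV. \<Sum>d\<in>UNIV. R a b i d * X c p $ a * Y c p $ b * Z c p $ d))"
  have component: "frame a c p $ a' = delta a' a" for a a'
    by (simp add: frame_chart p_dom \<rho>_inside p axis_def delta_def)
  have eval: "(\<Sum>a'\<in>UNIV. \<Sum>b'\<in>UNIV. \<Sum>d'\<in>UNIV. T a' b' i d' * frame a c p $ a' * frame b c p $ b' * frame d c p $ d') =
      T a b i d" for T :: "'n tensor4" and a b i d
    unfolding component by (simp add: delta_sums sum_distrib_right[symmetric])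
  show "R = local_curvature"
  proof (intro ext)
    fix a b i d
    show "R a b i d = local_curvature a b i d"
      using R[rule_format, of "frame a" "frame b" "frame d" i]
        curvature_identity[of "frame a" "frame b" "frame d" i]
      by (simp add: vector_field_frame eval)
  qed
qed

lemma local_curvature_skew: "local_curvature a b i d = - local_curvature b a i d"
  unfolding local_curvature_def by (rule christoffel_curvature_skew)

text \<open>The symbols are symmetric on the whole open set \<open>N\<close>, not only at
  \<open>p\<close>, so the symmetry may be differentiated.\<close>

lemma partial_christoffel_symmetric: "partial a (christoffel D b d) p = partial a (christoffel D d b) p"
proof -
  have "chart_deriv c (christoffel D b d) p = chart_deriv c (christoffel D d b) p"
    using differentiable_christoffel christoffel_symmetric[OF D torsion_free]
    by (intro chart_deriv_cong[OF c open_N N_dom p]) (auto simp: chart_differentiable_def)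
  then show ?thesis by simp
qed

lemma local_curvature_bianchi:
  "local_curvature a b i d + local_curvature b d i a + local_curvature d a i b = 0"
  unfolding local_curvature_def
  using christoffel_symmetric[OF D torsion_free p] partial_christoffel_symmetric
  by (intro christoffel_curvature_bianchi) simp_all

end

end

text \<open>Evaluated on frame fields, the defining relation gives the change of the Christoffel
  symbols on all of \<open>N\<close>, hence also of their derivatives at \<open>p\<close>. The rest
  is the algebraic lemma on a projective change.\<close>

lemma local_curvature_projective_change:
  assumes D: "affine_connection A D" "torsion_free A D" and p: "p \<in> N"
    and D': "affine_connection A D'" "torsion_free A D'"
    and eq: "projectively_equivalent A D D'"
  shows "\<exists>S. \<forall>a b i d. local_curvature D' p a b i d = local_curvature D p a b i d +
    (delta i a * S b d - delta i b * S a d) - (S a b - S b a) * delta i d"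
proof -
  obtain \<Upsilon> where \<Upsilon>: "one_form A \<Upsilon>"
    and change: "\<And>X Y q. vector_field A X \<Longrightarrow> vector_field A Y \<Longrightarrow> q \<in> dom_chart c \<Longrightarrow>
      D' X Y c q = D X Y c q + (\<Upsilon> c q \<bullet> X c q) *\<^sub>R Y c q + (\<Upsilon> c q \<bullet> Y c q) *\<^sub>R X c q"
    using eq c unfolding projectively_equivalent_def by blast
  have pc: "p \<in> dom_chart c" using p N_dom by blast
  have smooth_\<Upsilon>: "smooth_on (coord c ` dom_chart c) (in_chart c (\<Upsilon> c))"
    using \<Upsilon> c unfolding one_form_def by blast
  note dif_\<Upsilon> = chart_differentiable_smooth[OF smooth_\<Upsilon> pc]
  note dif_christoffel = differentiable_christoffel[OF D(1) p]
  have christoffel': "christoffel D' i j q = christoffel D i j q + \<Upsilon> c q $ i *\<^sub>R axis j 1 + \<Upsilon> c q $ j *\<^sub>R axis i 1"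
    if "q \<in> N" for i j q
    using that N_dom change[OF vector_field_frame vector_field_frame, of q i j]
    by (auto simp: christoffel_def[OF D(1)] christoffel_def[OF D'(1)] frame_chart \<rho>_inside inner_axis)
  define u where "u i = \<Upsilon> c p $ i" for i
  define du where "du a i = chart_deriv c (\<Upsilon> c) p (axis a 1) $ i" for a i
  have "chart_deriv c (christoffel D' i j) p =
      chart_deriv c (\<lambda>q. christoffel D i j q + \<Upsilon> c q $ i *\<^sub>R axis j 1 + \<Upsilon> c q $ j *\<^sub>R axis i 1) p" for i j
    using differentiable_christoffel[OF D'(1) p]
    by (intro chart_deriv_cong[OF c open_N N_dom p]) (simp_all add: christoffel' chart_differentiable_def)
  then have dG': "chart_deriv c (christoffel D' b d) p (axis a 1) $ i =
      chart_deriv c (christoffel D b d) p (axis a 1) $ i + du a b * delta i d + du a d * delta i b" for a b d i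
    by (simp add: chart_deriv_add chart_deriv_scaleR chart_deriv_nth chart_deriv_const c pc dif_\<Upsilon> dif_christoffel
        du_def delta_def axis_def)
  have G': "christoffel D' a b p $ i = christoffel D a b p $ i + u a * delta i b + u b * delta i a" for a b i
    by (simp add: christoffel' p u_def delta_def axis_def)
  define S where "S b d = - du b d + (\<Sum>e\<in>UNIV. u e * christoffel D b d p $ e) + u b * u d" for b d
  have "local_curvature D' p a b i d = local_curvature D p a b i d +
    (delta i a * S b d - delta i b * S a d) + (du a b - du b a) * delta i d" for a b i d
    unfolding local_curvature_def[OF D(1) p] local_curvature_def[OF D'(1) p] dG' G' S_def
    by (rule christoffel_curvature_projective_change)
      (simp add: christoffel_symmetric[OF D p])
  \<comment> \<open>The other two terms of \<open>S\<close> are symmetric, so its skew part is minus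
    that of \<open>du\<close>; this matches the relation between P and \<beta> in the
    decomposition.\<close>
  moreover have "du a b - du b a = - (S a b - S b a)" for a b
    using christoffel_symmetric[OF D p, of a b] by (simp add: S_def)
  ultimately show ?thesis by (intro exI[of _ S]) (simp add: algebra_simps)
qed

end

section \<open>Curvature identities freed from the choice of a cutoff\<close>

context manifold
begin

lemma cutoff_exists:
  assumes "c \<in> A" "p \<in> dom_chart c"
  obtains \<rho> K N where "cutoff M A c \<rho> K N" "p \<in> N"
proof -
  show ?thesis
  proof (rule cutoff_function[OF assms])
    fix \<rho> :: "'a \<Rightarrow> real" and K N
    assume *: "closedin M K" "K \<subseteq> dom_chart c" "openin M N" "p \<in> N" "N \<subseteq> dom_chart c"
      "smooth_on (coord c ` dom_chart c) (in_chart c \<rho>)"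
      "\<And>q. q \<notin> K \<Longrightarrow> \<rho> q = 0" "\<And>q. q \<in> N \<Longrightarrow> \<rho> q = 1"
    have "cutoff M A c \<rho> K N"
      by unfold_locales (use assms(1) * in auto)
    then show ?thesis using \<open>p \<in> N\<close> by (rule that)
  qed
qed

lemma curvature_skew:
  assumes "affine_connection A D" "torsion_free A D" "c \<in> A" "p \<in> dom_chart c"
  shows "curvature A D c p a b i d = - curvature A D c p b a i d"
proof -
  obtain \<rho> K N where "cutoff M A c \<rho> K N" and p: "p \<in> N"
    using cutoff_exists[OF assms(3,4)] .
  then interpret cutoff M A c \<rho> K N by simp
  show ?thesis
    unfolding curvature_eq_local_curvature[OF assms(1) p assms(2)]
    by (rule local_curvature_skew[OF assms(1) p assms(2)])
qed

lemma curvature_bianchi: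
  assumes "affine_connection A D" "torsion_free A D" "c \<in> A" "p \<in> dom_chart c"
  shows "curvature A D c p a b i d + curvature A D c p b d i a + curvature A D c p d a i b = 0"
proof -
  obtain \<rho> K N where "cutoff M A c \<rho> K N" and p: "p \<in> N"
    using cutoff_exists[OF assms(3,4)] .
  then interpret cutoff M A c \<rho> K N by simp
  show ?thesis
    unfolding curvature_eq_local_curvature[OF assms(1) p assms(2)]
    by (rule local_curvature_bianchi[OF assms(1) p assms(2)])
qed

lemma curvature_projective_change:
  assumes D: "affine_connection A D" "torsion_free A D"
    and D': "affine_connection A D'" "torsion_free A D'"
    and "projectively_equivalent A D D'" "c \<in> A" "p \<in> dom_chart c"
  obtains S where "\<And>a b i d. curvature A D' c p a b i d = curvature A D c p a b i d +
    (delta i a * S b d - delta i b * S a d) - (S a b - S b a) * delta i d"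
proof -
  obtain \<rho> K N where "cutoff M A c \<rho> K N" and p: "p \<in> N"
    using cutoff_exists[OF assms(6,7)] .
  then interpret cutoff M A c \<rho> K N by simp
  obtain S where "\<forall>a b i d. curvature A D' c p a b i d = curvature A D c p a b i d +
    (delta i a * S b d - delta i b * S a d) - (S a b - S b a) * delta i d"
    using local_curvature_projective_change[OF D p D' assms(5)]
    unfolding curvature_eq_local_curvature[OF D(1) p D(2), symmetric]
      curvature_eq_local_curvature[OF D'(1) p D'(2), symmetric] ..
  then show ?thesis by (intro that[of S]) blast
qed

end

section \<open>Antisymmetrised cyclic traces\<close>

lemma skew_part_add: "skew_part m (\<lambda>a. S a + T a) a = skew_part m S a + skew_part m T a"
  by (simp add: skew_part_def distrib_left sum.distrib add_divide_distrib)

lemma skew_part_diff: "skew_part m (\<lambda>a. S a - T a) a = skew_part m S a - skew_part m T a"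
  by (simp add: skew_part_def right_diff_distrib sum_subtractf diff_divide_distrib)

lemma skew_part_permute:
  assumes "\<tau> permutes {..<m}"
  shows "skew_part m (\<lambda>a. T (a \<circ> \<tau>)) a = of_int (sign \<tau>) * skew_part m T a"
proof -
  have perm: "permutation \<sigma>" if "\<sigma> permutes {..<m}" for \<sigma>
    using that by (rule permutes_imp_permutation[OF finite_lessThan])
  have "(\<Sum>\<sigma> | \<sigma> permutes {..<m}. of_int (sign \<sigma>) * T (a \<circ> \<sigma>)) =
      (\<Sum>\<sigma> | \<sigma> permutes {..<m}. of_int (sign (\<sigma> \<circ> \<tau>)) * T (a \<circ> (\<sigma> \<circ> \<tau>)))"
    by (rule sum_permutations_compose_right[OF assms])
  also have "\<dots> = of_int (sign \<tau>) * (\<Sum>\<sigma> | \<sigma> permutes {..<m}. of_int (sign \<sigma>) * T (a \<circ> \<sigma> \<circ> \<tau>))"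
    by (simp add: sum_distrib_left sign_compose perm assms ac_simps comp_assoc)
  finally have "of_int (sign \<tau>) * (\<Sum>\<sigma> | \<sigma> permutes {..<m}. of_int (sign \<sigma>) * T (a \<circ> \<sigma>)) =
      (\<Sum>\<sigma> | \<sigma> permutes {..<m}. of_int (sign \<sigma>) * T (a \<circ> \<sigma> \<circ> \<tau>))"
    by (simp add: mult.assoc[symmetric] flip: of_int_mult)
  then show ?thesis
    by (simp add: skew_part_def)
qed

text \<open>A three-cycle is even, so the three terms of the cyclic sum have the same skew part, and
  three times it is the skew part of 0.\<close>

lemma skew_part_three_cycle:
  assumes xyz: "x < m" "y < m" "z < m" "x \<noteq> y" "y \<noteq> z" "x \<noteq> z"
    and cyc: "\<And>a. T a + T (a(x := a y, y := a z, z := a x)) + T (a(x := a z, y := a x, z := a y)) = 0"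
  shows "skew_part m T a = 0"
proof -
  define \<tau> where "\<tau> = Transposition.transpose x y \<circ> Transposition.transpose y z"
  have p1: "Transposition.transpose x y permutes {..<m}" and p2: "Transposition.transpose y z permutes {..<m}"
    using xyz by (auto intro: permutes_swap_id)
  then have perm: "\<tau> permutes {..<m}" unfolding \<tau>_def using permutes_compose by blast
  have sign: "sign \<tau> = 1"
    using xyz permutes_imp_permutation[OF finite_lessThan p1] permutes_imp_permutation[OF finite_lessThan p2]
    by (simp add: \<tau>_def sign_compose sign_swap_id)
  have \<tau>: "b \<circ> \<tau> = b(x := b y, y := b z, z := b x)" for b :: "nat \<Rightarrow> 'a"
    using xyz by (auto simp: \<tau>_def fun_eq_iff Transposition.transpose_def)
  have \<tau>\<tau>: "b \<circ> \<tau> \<circ> \<tau> = b(x := b z, y := b x, z := b y)" for b :: "nat \<Rightarrow> 'a"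
    unfolding \<tau> using xyz by (auto simp: fun_eq_iff)
  have "skew_part m (\<lambda>a. T (a \<circ> \<tau>)) a = skew_part m T a"
    "skew_part m (\<lambda>a. T (a \<circ> \<tau> \<circ> \<tau>)) a = skew_part m T a"
    using skew_part_permute[OF perm, of T a] skew_part_permute[OF perm, of "\<lambda>a. T (a \<circ> \<tau>)" a] sign by simp_all
  then have "3 * skew_part m T a = skew_part m (\<lambda>a. T a + T (a \<circ> \<tau>) + T (a \<circ> \<tau> \<circ> \<tau>)) a"
    by (simp add: skew_part_add)
  also have "\<dots> = 0" unfolding \<tau>\<tau> unfolding \<tau> cyc by (simp add: skew_part_def)
  finally show ?thesis by simp
qed

text \<open>Different factors are allowed so that \<open>R\<close> can be replaced by \<open>W\<close> one factor at a time.\<close>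

definition mixed_trace :: "nat \<Rightarrow> (nat \<Rightarrow> 'n::finite tensor4) \<Rightarrow> (nat \<Rightarrow> 'n) \<Rightarrow> real" where
  "mixed_trace k T a =
     (\<Sum>c \<in> {..<k} \<rightarrow>\<^sub>E UNIV. \<Prod>i<k. T i (a (2 * i)) (a (2 * i + 1)) (c i) (c ((i + 1) mod k)))"

lemma cyclic_trace_eq_mixed_trace: "cyclic_trace k R = mixed_trace k (\<lambda>_. R)"
  by (simp add: fun_eq_iff cyclic_trace_def mixed_trace_def)

lemma mixed_trace_split:
  assumes "m < k"
  shows "mixed_trace k T a = (\<Sum>c \<in> {..<k} \<rightarrow>\<^sub>E UNIV. T m (a (2 * m)) (a (2 * m + 1)) (c m) (c ((m + 1) mod k)) *
    (\<Prod>i\<in>{..<k} - {m}. T i (a (2 * i)) (a (2 * i + 1)) (c i) (c ((i + 1) mod k))))"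
  unfolding mixed_trace_def by (intro sum.cong refl prod.remove) (use assms in auto)

lemma mixed_trace_cong: "(\<And>i. i < k \<Longrightarrow> S i = T i) \<Longrightarrow> mixed_trace k S = mixed_trace k T"
  by (simp add: mixed_trace_def fun_eq_iff)

text \<open>The trace is linear in its factor at \<open>m\<close> when the other factors are held
  fixed.\<close>

lemma mixed_trace_diff:
  assumes "m < k" "\<And>i. i < k \<Longrightarrow> i \<noteq> m \<Longrightarrow> S i = T i" "\<And>i. i < k \<Longrightarrow> i \<noteq> m \<Longrightarrow> U i = T i"
    and "\<And>a b c d. U m a b c d = S m a b c d - T m a b c d"
  shows "mixed_trace k S a - mixed_trace k T a = mixed_trace k U a"
proof -
  have "(\<Prod>i\<in>{..<k} - {m}. S i (a (2 * i)) (a (2 * i + 1)) (c i) (c ((i + 1) mod k))) =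
      (\<Prod>i\<in>{..<k} - {m}. T i (a (2 * i)) (a (2 * i + 1)) (c i) (c ((i + 1) mod k)))"
    "(\<Prod>i\<in>{..<k} - {m}. U i (a (2 * i)) (a (2 * i + 1)) (c i) (c ((i + 1) mod k))) =
      (\<Prod>i\<in>{..<k} - {m}. T i (a (2 * i)) (a (2 * i + 1)) (c i) (c ((i + 1) mod k)))" for c
    using assms(2,3) by (auto intro!: prod.cong)
  then show ?thesis
    by (simp add: mixed_trace_split[OF assms(1)] assms(4) sum_subtractf left_diff_distrib)
qed

text \<open>An index assignment splits into its value at \<open>m\<close>, which the delta fixes,
  and its values on \<open>S\<close>.\<close>

lemma sum_PiE_delta:
  fixes h :: "('i \<Rightarrow> 'n::finite) \<Rightarrow> real"
  assumes "m \<notin> S" "finite S"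
  shows "(\<Sum>c\<in>insert m S \<rightarrow>\<^sub>E UNIV. delta (c m) x * h c) = (\<Sum>c\<in>S \<rightarrow>\<^sub>E UNIV. h (c(m := x)))"
proof -
  have "(\<Sum>c\<in>insert m S \<rightarrow>\<^sub>E UNIV. delta (c m) x * h c) =
      (\<Sum>(y, c)\<in>UNIV \<times> (S \<rightarrow>\<^sub>E UNIV). delta y x * h (c(m := y)))"
    unfolding PiE_insert_eq
    by (subst sum.reindex[OF inj_combinator[OF assms(1)]]) (simp add: o_def case_prod_unfold)
  also have "\<dots> = (\<Sum>c\<in>S \<rightarrow>\<^sub>E UNIV. \<Sum>y\<in>UNIV. delta y x * h (c(m := y)))"
    by (subst sum.cartesian_product[symmetric]) (rule sum.swap)
  finally show ?thesis by (simp add: delta_sums)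
qed

definition schouten_part :: "'n tensor2 \<Rightarrow> 'n tensor4" where
  "schouten_part P a b c d = delta c a * P b d - delta c b * P a d"

text \<open>The contraction of \<open>\<delta>\<^sup>c\<^sub>a\<close> with the preceding factor turns the lower index of that factor
  into a skewed one, so the first Bianchi identity makes it vanish.\<close>

lemma skew_part_mixed_trace_delta:
  fixes T :: "nat \<Rightarrow> 'n::finite tensor4"
  assumes m: "m < k" and l: "l < k" "l \<noteq> m" "(l + 1) mod k = m"
    and T: "\<And>a b c d. T m a b c d = delta c a * P b d"
    and bianchi: "\<And>a b c d. T l a b c d + T l b d c a + T l d a c b = 0"
  shows "skew_part (2 * k) (mixed_trace k T) a = 0"
proof -
  let ?S = "{..<k} - {m}"
  let ?rest = "\<lambda>a c. P (a (2 * m + 1)) (c ((m + 1) mod k)) *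
     (\<Prod>i\<in>?S - {l}. T i (a (2 * i)) (a (2 * i + 1)) (c i) (c ((i + 1) mod k)))"
  \<comment> \<open>The cyclic successor is injective, so the summation index \<open>c m\<close>
    occurs just twice: as upper index of factor \<open>m\<close> and as lower index of factor
    \<open>l\<close>.\<close>
  have succ_inj: "i = l" if "i < k" "(i + 1) mod k = m" for i
    using that l by (cases "i + 1 = k"; cases "l + 1 = k") auto
  have succ_m: "(m + 1) mod k \<noteq> m"
    using succ_inj[OF m] l by auto
  have rest: "?rest a (c(m := y)) = ?rest a c" for a c y
  proof -
    have "(\<Prod>i\<in>?S - {l}. T i (a (2 * i)) (a (2 * i + 1)) ((c(m := y)) i) ((c(m := y)) ((i + 1) mod k))) =
        (\<Prod>i\<in>?S - {l}. T i (a (2 * i)) (a (2 * i + 1)) (c i) (c ((i + 1) mod k)))"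
    proof (rule prod.cong[OF refl])
      fix i assume "i \<in> ?S - {l}"
      then have "i \<noteq> m" "(i + 1) mod k \<noteq> m" using succ_inj by blast+
      then show "T i (a (2 * i)) (a (2 * i + 1)) ((c(m := y)) i) ((c(m := y)) ((i + 1) mod k)) =
          T i (a (2 * i)) (a (2 * i + 1)) (c i) (c ((i + 1) mod k))"
        by (simp only: fun_upd_other not_False_eq_True)
    qed
    then show ?thesis by (simp only: fun_upd_other[OF succ_m])
  qed
  have "mixed_trace k T a = (\<Sum>c \<in> insert m ?S \<rightarrow>\<^sub>E UNIV. delta (c m) (a (2 * m)) *
      (T l (a (2 * l)) (a (2 * l + 1)) (c l) (c m) * ?rest a c))" for a
  proof -
    have "insert m ?S = {..<k}" using m by auto
    moreover have "(\<Prod>i\<in>?S. T i (a (2 * i)) (a (2 * i + 1)) (c i) (c ((i + 1) mod k))) =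
        T l (a (2 * l)) (a (2 * l + 1)) (c l) (c m) *
        (\<Prod>i\<in>?S - {l}. T i (a (2 * i)) (a (2 * i + 1)) (c i) (c ((i + 1) mod k)))" for c
      using l by (subst prod.remove[of _ l]) auto
    ultimately show ?thesis
      by (simp add: mixed_trace_split[OF m] T ac_simps)
  qed
  also have "\<dots> a = (\<Sum>c \<in> ?S \<rightarrow>\<^sub>E UNIV. T l (a (2 * l)) (a (2 * l + 1)) (c l) (a (2 * m)) * ?rest a c)" for a
    by (subst sum_PiE_delta) (simp_all only: rest, simp_all add: l)
  finally have trace: "mixed_trace k T a =
      (\<Sum>c \<in> ?S \<rightarrow>\<^sub>E UNIV. T l (a (2 * l)) (a (2 * l + 1)) (c l) (a (2 * m)) * ?rest a c)" for a .
  have odd: "2 * l + 1 \<noteq> 2 * m" "2 * m + 1 \<noteq> 2 * l" by presburger+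
  \<comment> \<open>The three slots to be permuted are absent from the rest: factor \<open>l\<close>
    has been split off, and of the slots of factor \<open>m\<close> only \<open>2 * m + 1\<close>
    remains, as an index of \<open>P\<close>.\<close>
  have rest_indep: "?rest (a(2 * l := u, 2 * l + 1 := v, 2 * m := w)) c = ?rest a c" for a c u v w
  proof -
    let ?b = "a(2 * l := u, 2 * l + 1 := v, 2 * m := w)"
    have "?b (2 * i) = a (2 * i)" "?b (2 * i + 1) = a (2 * i + 1)" if "i \<in> ?S - {l}" for i
    proof -
      have "2 * i \<noteq> 2 * m" "2 * i \<noteq> 2 * l" "2 * i + 1 \<noteq> 2 * l + 1" using that by auto
      moreover have "2 * i \<noteq> 2 * l + 1" "2 * i + 1 \<noteq> 2 * m" "2 * i + 1 \<noteq> 2 * l" by presburger+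
      ultimately show "?b (2 * i) = a (2 * i)" "?b (2 * i + 1) = a (2 * i + 1)"
        by (simp_all only: fun_upd_other not_False_eq_True)
    qed
    then have "(\<Prod>i\<in>?S - {l}. T i (?b (2 * i)) (?b (2 * i + 1)) (c i) (c ((i + 1) mod k))) =
        (\<Prod>i\<in>?S - {l}. T i (a (2 * i)) (a (2 * i + 1)) (c i) (c ((i + 1) mod k)))"
      by (intro prod.cong refl) (simp only:)
    moreover have "2 * m + 1 \<noteq> 2 * m" "2 * m + 1 \<noteq> 2 * l + 1" "2 * m + 1 \<noteq> 2 * l"
      using l(2) odd by auto
    then have "?b (2 * m + 1) = a (2 * m + 1)" by (simp only: fun_upd_other not_False_eq_True)
    ultimately show ?thesis by (simp only:)
  qed
  show ?thesis
  proof (rule skew_part_three_cycle[of "2 * l" _ "2 * l + 1" "2 * m"])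
    fix a :: "nat \<Rightarrow> 'n"
    show "mixed_trace k T a +
        mixed_trace k T (a(2 * l := a (2 * l + 1), 2 * l + 1 := a (2 * m), 2 * m := a (2 * l))) +
        mixed_trace k T (a(2 * l := a (2 * m), 2 * l + 1 := a (2 * l), 2 * m := a (2 * l + 1))) = 0"
      unfolding trace rest_indep sum.distrib[symmetric] distrib_right[symmetric]
      using l(2) odd bianchi by simp
  qed (use l m odd in auto)
qed

text \<open>The second half of \<open>schouten_part\<close> is the first with the slots
  \<open>2 * m\<close> and \<open>2 * m + 1\<close> exchanged. Up to sign its skewed trace is
  therefore that of the first half, which vanishes.\<close>

lemma skew_part_mixed_trace_schouten_part:
  fixes T :: "nat \<Rightarrow> 'n::finite tensor4"
  assumes m: "m < k" and l: "l < k" "l \<noteq> m" "(l + 1) mod k = m"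
    and T: "T m = schouten_part P"
    and bianchi: "\<And>a b c d. T l a b c d + T l b d c a + T l d a c b = 0"
  shows "skew_part (2 * k) (mixed_trace k T) a = 0"
proof -
  define T1 where "T1 = T(m := \<lambda>a b c d. delta c a * P b d)"
  define T2 where "T2 = T(m := \<lambda>a b c d. delta c b * P a d)"
  let ?\<tau> = "Transposition.transpose (2 * m) (2 * m + 1)"
  have "mixed_trace k T1 a - mixed_trace k T2 a = mixed_trace k T a" for a
    by (rule mixed_trace_diff[OF m]) (auto simp: T1_def T2_def T schouten_part_def)
  then have eq: "mixed_trace k T = (\<lambda>a. mixed_trace k T1 a - mixed_trace k T2 a)"
    by simp
  have "mixed_trace k T2 a = mixed_trace k T1 (a \<circ> ?\<tau>)" for a
    unfolding mixed_trace_def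
  proof (intro sum.cong prod.cong refl)
    fix c i
    have "i \<noteq> m \<Longrightarrow> 2 * i \<noteq> 2 * m + 1 \<and> 2 * i + 1 \<noteq> 2 * m" by presburger
    then show "T2 i (a (2 * i)) (a (2 * i + 1)) (c i) (c ((i + 1) mod k)) =
        T1 i ((a \<circ> ?\<tau>) (2 * i)) ((a \<circ> ?\<tau>) (2 * i + 1)) (c i) (c ((i + 1) mod k))"
      by (cases "i = m") (auto simp: T1_def T2_def Transposition.transpose_def)
  qed
  moreover have "?\<tau> permutes {..<2 * k}"
    using m by (intro permutes_swap_id) auto
  ultimately have "skew_part (2 * k) (mixed_trace k T2) a =
      of_int (sign ?\<tau>) * skew_part (2 * k) (mixed_trace k T1) a"
    using skew_part_permute[of ?\<tau> "2 * k" "mixed_trace k T1" a] by presburger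
  moreover have "skew_part (2 * k) (mixed_trace k T1) a = 0"
    by (rule skew_part_mixed_trace_delta[OF m l, of _ P]) (use l(2) bianchi in \<open>auto simp: T1_def\<close>)
  ultimately show ?thesis
    by (simp add: eq skew_part_diff)
qed

lemma skew_part_cyclic_trace_eq:
  fixes R W :: "'n::finite tensor4"
  assumes sym: "\<And>a b. P a b = P b a"
    and bianchi: "\<And>a b c d. R a b c d + R b d c a + R d a c b = 0"
    and R: "\<And>a b c d. R a b c d = W a b c d + schouten_part P a b c d"
  shows "skew_part (2 * k) (cyclic_trace k R) a = skew_part (2 * k) (cyclic_trace k W) a"
proof -
  \<comment> \<open>The first \<open>j\<close> factors are already \<open>W\<close>, the others
    still \<open>R\<close>; raising \<open>j\<close> by one changes factor \<open>j\<close> only, by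
    \<open>schouten_part P\<close>.\<close>
  define T where "T j i = (if i < j then W else R)" for j i :: nat
  \<comment> \<open>In the cyclic sum of \<open>schouten_part P\<close> each delta is multiplied by
    a difference of the form P_bd - P_db, which is 0.\<close>
  have bianchi_W: "W a b c d + W b d c a + W d a c b = 0" for a b c d
    using bianchi[of a b c d] sym[of b d] sym[of a d] sym[of a b]
    unfolding R schouten_part_def by algebra
  have step: "skew_part (2 * k) (mixed_trace k (T j)) a = skew_part (2 * k) (mixed_trace k (T (Suc j))) a"
    if j: "j < k" for j
  proof -
    let ?U = "(T j)(j := schouten_part P)"
    have "mixed_trace k (T j) a - mixed_trace k (T (Suc j)) a = mixed_trace k ?U a" for a
      by (rule mixed_trace_diff[OF j]) (auto simp: T_def R)
    then have U: "mixed_trace k ?U = (\<lambda>a. mixed_trace k (T j) a - mixed_trace k (T (Suc j)) a)"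
      by simp
    have "skew_part (2 * k) (mixed_trace k ?U) a = 0"
    \<comment> \<open>For \<open>k = 1\<close> the factor is its own predecessor, so the trace is
      computed directly: it vanishes by the symmetry of \<open>P\<close>, even before
      skewing.\<close>
    proof (cases "k = 1")
      case True
      have "mixed_trace k ?U = (\<lambda>a. 0)"
      proof
        fix a :: "nat \<Rightarrow> 'n"
        have "(\<Sum>c\<in>insert (0::nat) {} \<rightarrow>\<^sub>E (UNIV :: 'n set). delta (c 0) (a 0) * P (a 1) (c 0)) = P (a 1) (a 0)"
          "(\<Sum>c\<in>insert (0::nat) {} \<rightarrow>\<^sub>E (UNIV :: 'n set). delta (c 0) (a 1) * P (a 0) (c 0)) = P (a 0) (a 1)"
          by (subst sum_PiE_delta; simp)+
        moreover have "{..<1} = insert (0::nat) {}" by auto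
        ultimately show "mixed_trace k ?U a = 0"
          using True j sym[of "a 0" "a 1"]
          by (simp add: mixed_trace_def schouten_part_def sum_subtractf del: PiE_empty_domain)
      qed
      then show ?thesis by (simp add: skew_part_def)
    next
      case False
      \<comment> \<open>The cyclic predecessor of \<open>j\<close>. For \<open>j = 0\<close> it is
        the last factor, still \<open>R\<close>; otherwise it has already become \<open>W\<close>.
        Either way it satisfies the Bianchi identity.\<close>
      define l where "l = (if j = 0 then k - 1 else j - 1)"
      have "l < k" "l \<noteq> j" "(l + 1) mod k = j"
        using j False by (auto simp: l_def)
      then show ?thesis
        using bianchi bianchi_W by (intro skew_part_mixed_trace_schouten_part[OF j, of l _ P]) (auto simp: T_def)
    qed
    then show ?thesis by (simp add: U skew_part_diff)
  qed
  have "j \<le> k \<Longrightarrow> skew_part (2 * k) (mixed_trace k (T 0)) a = skew_part (2 * k) (mixed_trace k (T j)) a" for j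
    by (induction j) (simp_all add: step)
  from this[of k] show ?thesis
    using mixed_trace_cong[of k "T 0" "\<lambda>_. R"] mixed_trace_cong[of k "T k" "\<lambda>_. W"]
    by (simp add: cyclic_trace_eq_mixed_trace T_def)
qed

section \<open>The Weyl tensor of a given decomposition and under projective change\<close>

lemma weyl_schouten_eqI:
  fixes R W :: "'n::finite tensor4"
  assumes "CARD('n) \<ge> 2" "projective_decomposition R W P \<beta>"
  shows "weyl R = W" "schouten R = P"
proof -
  have "W' = W \<and> P' = P" if "projective_decomposition R W' P' \<beta>'" for W' P' \<beta>'
    using projective_decomposition_unique[OF assms] projective_decomposition_unique[OF assms(1) that] by simp
  then show "weyl R = W" "schouten R = P"
    unfolding weyl_def schouten_def using assms(2) by (blast intro!: the_equality)+
qed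

text \<open>The decomposition of \<open>R\<close> turns into one of \<open>R'\<close>:
  \<open>S\<close> is absorbed into \<open>P\<close>, its skew part into \<beta>, and
  \<open>W\<close> stays as it is.\<close>

lemma weyl_projective_change:
  fixes R R' :: "'n::finite tensor4"
  assumes n: "CARD('n) \<ge> 2" and dec: "projective_decomposition R W P \<beta>"
    and R': "\<And>a b c d. R' a b c d = R a b c d + (delta c a * S b d - delta c b * S a d) - (S a b - S b a) * delta c d"
  shows "weyl R' = weyl R"
proof -
  have "projective_decomposition R' W (\<lambda>a b. P a b + S a b) (\<lambda>a b. \<beta> a b - (S a b - S b a))"
    using dec unfolding projective_decomposition_def R' by (simp add: algebra_simps)
  from weyl_schouten_eqI(1)[OF n this] weyl_schouten_eqI(1)[OF n dec] show ?thesis by simp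
qed

section \<open>Curvature forms of scale connections\<close>

context manifold
begin

text \<open>Existence rests on the skew symmetry and the Bianchi identity of the curvature. By
  uniqueness \<open>P\<close> is the Schouten tensor, whose symmetry is the defining property of a
  scale connection and forces \<beta> to vanish.\<close>

lemma scale_connection_decomposition:
  assumes n: "CARD('n) \<ge> 2" and D: "scale_connection A D" and cp: "c \<in> A" "p \<in> dom_chart c"
  shows "\<exists>W P. projective_decomposition (curvature A D c p) W P (\<lambda>a b. 0) \<and> (\<forall>a b. P a b = P b a)"
proof -
  have D': "affine_connection A D" "torsion_free A D"
    using D by (auto simp: scale_connection_def)
  obtain W P \<beta> where dec: "projective_decomposition (curvature A D c p) W P \<beta>"
    using projective_decomposition_exists[OF n curvature_skew[OF D' cp] curvature_bianchi[OF D' cp]] .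
  have sym: "P a b = P b a" for a b
    using D cp weyl_schouten_eqI(2)[OF n dec] unfolding scale_connection_def by blast
  then have "\<beta> = (\<lambda>a b. 0)"
    using dec by (simp add: projective_decomposition_def fun_eq_iff)
  with dec sym show ?thesis by blast
qed

lemma curvature_form_eq_weyl:
  assumes n: "CARD('n) \<ge> 2" and D: "scale_connection A D" and cp: "c \<in> A" "p \<in> dom_chart c"
  shows "curvature_form k A D c p a = skew_part (2 * k) (cyclic_trace k (weyl (curvature A D c p))) a"
proof -
  have D': "affine_connection A D" "torsion_free A D"
    using D by (auto simp: scale_connection_def)
  obtain W P where dec: "projective_decomposition (curvature A D c p) W P (\<lambda>a b. 0)"
    and sym: "\<And>a b. P a b = P b a"
    using scale_connection_decomposition[OF n D cp] by blast
  have "curvature A D c p a b c' d = W a b c' d + schouten_part P a b c' d" for a b c' d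
    using dec by (simp add: projective_decomposition_def schouten_part_def)
  from skew_part_cyclic_trace_eq[where P = P, OF sym curvature_bianchi[OF D' cp] this]
  show ?thesis
    by (simp add: curvature_form_def weyl_schouten_eqI(1)[OF n dec])
qed

lemma weyl_projectively_equivalent:
  assumes n: "CARD('n) \<ge> 2" and D: "scale_connection A D" and D': "scale_connection A D'"
    and eq: "projectively_equivalent A D D'" and cp: "c \<in> A" "p \<in> dom_chart c"
  shows "weyl (curvature A D' c p) = weyl (curvature A D c p)"
proof -
  have "affine_connection A D" "torsion_free A D" "affine_connection A D'" "torsion_free A D'"
    using D D' by (auto simp: scale_connection_def)
  then obtain S where S: "\<And>a b i d. curvature A D' c p a b i d = curvature A D c p a b i d +
    (delta i a * S b d - delta i b * S a d) - (S a b - S b a) * delta i d"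
    using curvature_projective_change[OF _ _ _ _ eq cp] by blast
  obtain W P where "projective_decomposition (curvature A D c p) W P (\<lambda>a b. 0)"
    using scale_connection_decomposition[OF n D cp] by blast
  from weyl_projective_change[OF n this S] show ?thesis .
qed

end

theorem theorem4p1:
  fixes M :: "'a topology"
    and A :: "('a, 'n::finite) chart set"
    and D :: "('a, 'n) connection"
    and k :: nat
  assumes "smooth_manifold M A"
    and "CARD('n) \<ge> 2"
    and "scale_connection A D"
    and "k > 0"
  shows "(\<forall>c\<in>A. \<forall>p\<in>dom_chart c. \<forall>a.
            curvature_form k A D c p a =
              skew_part (2 * k) (cyclic_trace k (weyl (curvature A D c p))) a) \<and>
         (\<forall>D'. scale_connection A D' \<and> projectively_equivalent A D D' \<longrightarrow>
            (\<forall>c\<in>A. \<forall>p\<in>dom_chart c. \<forall>a.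
               curvature_form k A D' c p a = curvature_form k A D c p a))"
proof -
  interpret manifold M A
    using assms(1) by unfold_locales
  show ?thesis
    \<comment> \<open>\<open>D'\<close> is a scale connection as well, so both forms are the same
      expression in their Weyl tensors, and these coincide.\<close>
    using curvature_form_eq_weyl[OF assms(2)] weyl_projectively_equivalent[OF assms(2,3)] assms(3)
    by simp
qed

end
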